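(* Let $N\ge2$, $p,q\in(1,\infty)$, $R>0$ and $f\in C[0,R)$. Let $u,h\in C(\overline{B_R})$ be radial viscosity solutions to $-|Du|^{q-2}\Delta_p^N u=f(|x|)$ in $B_R\subset\mathbb{R}^N$ such that $u=h$ on $\partial B_R$. Then $u=h$.
   Context: $B_R\subset\mathbb{R}^N$ is the open ball of radius $R$ centred at the origin. A function $u$ is radial if $u(x)$ depends only on $|x|$. The normalized $p$-Laplacian is $\Delta_p^N u=\Delta u+\frac{p-2}{|Du|^2}\sum_{i,j=1}^N D_{ij}u\,D_iu\,D_ju$. A function $\varphi$ touches $u$ from below (resp. above) at $x_0\in B_R$ if $\varphi(x_0)=u(x_0)$ and $\varphi(x)<u(x)$ (resp. $\varphi(x)>u(x)$) for $x\ne x_0$ in a neighbourhood of $x_0$. A bounded lower semicontinuous $u:B_R\to\mathbb{R}$ is a viscosity supersolution to the equation in $B_R$ if whenever $\varphi$ is $C^2$ near $x_0\in B_R$, touches $u$ from below at $x_0$, and $D\varphi(x)\neq0$ for $x\ne x_0$ near $x_0$, then $$\limsup_{x_0\ne y\to x_0}\big(-|D\varphi(y)|^{q-2}\Delta_p^N\varphi(y)\big)-f(|x_0|)\ge0.$$ A bounded upper semicontinuous $u:B_R\to\mathbb{R}$ is a viscosity subsolution if whenever $\varphi$ is $C^2$ near $x_0\in B_R$, touches $u$ from above at $x_0$, and $D\varphi(x)\neq0$ for $x\ne x_0$ near $x_0$, then $$\liminf_{x_0\ne y\to x_0}\big(-|D\varphi(y)|^{q-2}\Delta_p^N\varphi(y)\big)-f(|x_0|)\le0.$$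 A viscosity solution is a function that is both a viscosity sub- and supersolution. *)

theory Defs
  imports "HOL-Analysis.Analysis"
begin

definition partial_deriv :: "'n \<Rightarrow> (real^'n \<Rightarrow> real) \<Rightarrow> real^'n \<Rightarrow> real" where
  "partial_deriv i u x = frechet_derivative u (at x) (axis i 1)"

definition gradient :: "(real^'n \<Rightarrow> real) \<Rightarrow> real^'n \<Rightarrow> real^'n" where
  "gradient u x = (\<chi> i. partial_deriv i u x)"

definition laplacian :: "(real^'n \<Rightarrow> real) \<Rightarrow> real^'n \<Rightarrow> real" where
  "laplacian u x = (\<Sum>i\<in>UNIV. partial_deriv i (partial_deriv i u) x)"

definition C2_near :: "(real^'n \<Rightarrow> real) \<Rightarrow> real^'n \<Rightarrow> bool" where
  "C2_near \<phi> x0 \<longleftrightarrow>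
    (\<exists>U. open U \<and> x0 \<in> U \<and> \<phi> differentiable_on U \<and>
      (\<forall>i. partial_deriv i \<phi> differentiable_on U) \<and>
      (\<forall>i j. continuous_on U (partial_deriv i (partial_deriv j \<phi>))))"

text \<open>Only meaningful at points where the gradient does not vanish; at the other
  points division by zero makes it the Laplacian. The definitions below evaluate it
  only where the gradient is nonzero.\<close>

definition normalized_p_laplacian :: "real \<Rightarrow> (real^'n \<Rightarrow> real) \<Rightarrow> real^'n \<Rightarrow> real" where
  "normalized_p_laplacian p u x =
    laplacian u x + (p - 2) / (norm (gradient u x))\<^sup>2 *
      (\<Sum>i\<in>UNIV. \<Sum>j\<in>UNIV.
        partial_deriv i (partial_deriv j u) x * partial_deriv i u x * partial_deriv j u x)"

definition touches_from_below ::
  "(real^'n \<Rightarrow> real) \<Rightarrow> (real^'n \<Rightarrow> real) \<Rightarrow> real^'n \<Rightarrow> bool" where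
  "touches_from_below \<phi> u x0 \<longleftrightarrow> \<phi> x0 = u x0 \<and> (\<forall>\<^sub>F x in at x0. \<phi> x < u x)"

definition touches_from_above ::
  "(real^'n \<Rightarrow> real) \<Rightarrow> (real^'n \<Rightarrow> real) \<Rightarrow> real^'n \<Rightarrow> bool" where
  "touches_from_above \<phi> u x0 \<longleftrightarrow> \<phi> x0 = u x0 \<and> (\<forall>\<^sub>F x in at x0. \<phi> x > u x)"

definition lower_semicontinuous_on :: "'a::topological_space set \<Rightarrow> ('a \<Rightarrow> real) \<Rightarrow> bool" where
  "lower_semicontinuous_on S u \<longleftrightarrow> (\<forall>x\<in>S. \<forall>c<u x. \<forall>\<^sub>F y in at x within S. c < u y)"

definition upper_semicontinuous_on :: "'a::topological_space set \<Rightarrow> ('a \<Rightarrow> real) \<Rightarrow> bool" where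
  "upper_semicontinuous_on S u \<longleftrightarrow> (\<forall>x\<in>S. \<forall>c>u x. \<forall>\<^sub>F y in at x within S. u y < c)"

definition radial_on :: "'a::real_normed_vector set \<Rightarrow> ('a \<Rightarrow> 'b) \<Rightarrow> bool" where
  "radial_on S u \<longleftrightarrow> (\<forall>x\<in>S. \<forall>y\<in>S. norm x = norm y \<longrightarrow> u x = u y)"

definition viscosity_supersolution ::
  "real \<Rightarrow> real \<Rightarrow> (real \<Rightarrow> real) \<Rightarrow> real \<Rightarrow> (real^'n \<Rightarrow> real) \<Rightarrow> bool" where
  "viscosity_supersolution p q f R u \<longleftrightarrow>
    bounded (u ` ball 0 R) \<and> lower_semicontinuous_on (ball 0 R) u \<and>
    (\<forall>x0\<in>ball 0 R. \<forall>\<phi>.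
      C2_near \<phi> x0 \<and> touches_from_below \<phi> u x0 \<and> (\<forall>\<^sub>F x in at x0. gradient \<phi> x \<noteq> 0) \<longrightarrow>
      Limsup (at x0) (\<lambda>y. ereal (- (norm (gradient \<phi> y) powr (q - 2) *
          normalized_p_laplacian p \<phi> y))) - ereal (f (norm x0)) \<ge> 0)"

definition viscosity_subsolution ::
  "real \<Rightarrow> real \<Rightarrow> (real \<Rightarrow> real) \<Rightarrow> real \<Rightarrow> (real^'n \<Rightarrow> real) \<Rightarrow> bool" where
  "viscosity_subsolution p q f R u \<longleftrightarrow>
    bounded (u ` ball 0 R) \<and> upper_semicontinuous_on (ball 0 R) u \<and>
    (\<forall>x0\<in>ball 0 R. \<forall>\<phi>.
      C2_near \<phi> x0 \<and> touches_from_above \<phi> u x0 \<and> (\<forall>\<^sub>F x in at x0. gradient \<phi> x \<noteq> 0) \<longrightarrow>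
      Liminf (at x0) (\<lambda>y. ereal (- (norm (gradient \<phi> y) powr (q - 2) *
          normalized_p_laplacian p \<phi> y))) - ereal (f (norm x0)) \<le> 0)"

definition viscosity_solution ::
  "real \<Rightarrow> real \<Rightarrow> (real \<Rightarrow> real) \<Rightarrow> real \<Rightarrow> (real^'n \<Rightarrow> real) \<Rightarrow> bool" where
  "viscosity_solution p q f R u \<longleftrightarrow>
    viscosity_subsolution p q f R u \<and> viscosity_supersolution p q f R u"

end

theory Submission
  imports Defs
begin

text \<open>A radial solution \<open>U(r)\<close> should satisfy the flux equation \<open>P' = - k\<close> with
  \<open>P = \<bar>r\<^sup>\<alpha> U'\<bar>\<^sup>q\<^sup>-\<^sup>2 r\<^sup>\<alpha> U'\<close>, \<open>\<alpha> = (N - 1) / (p - 1)\<close>, where \<open>k\<close> depends only on the data.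
  Test functions with nonzero gradient suffice to compare \<open>U\<close> with exact solutions of nonzero flux.
  On an interval where the difference quotient of \<open>U\<close> is large compared with a power of its length,
  the exact solution with the same boundary values has nonzero flux, hence coincides with \<open>U\<close>;
  a point contained in no such interval satisfies \<open>U' = 0\<close>. So \<open>U\<close> is differentiable, and the flux
  equation holds where \<open>P \<noteq> 0\<close>. Where \<open>U\<close> is locally constant, the test functions
  \<open>\<bar>x - x0\<bar>\<^sup>2\<^sup>m\<close> show \<open>f = 0\<close>, and this suffices to extend the flux equation across the zeros
  of \<open>P\<close>. Hence \<open>P = C - \<integral> k\<close>; if \<open>C\<close> were nonzero, \<open>U\<close> would have infinite slope at the
  origin and could be touched there by arbitrarily steep paraboloids with unit gradient. Therefore
  \<open>C = 0\<close>, \<open>U'\<close> is determined by \<open>f\<close>, and two solutions differ by a constant.\<close>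

section \<open>Test functions in space\<close>

lemma partial_deriv_eqI:
  "(u has_derivative u') (at x) \<Longrightarrow> partial_deriv i u x = u' (axis i 1)"
  unfolding partial_deriv_def using frechet_derivative_at by metis

lemma partial_deriv_transform_within_open:
  assumes "u differentiable at x" "open S" "x \<in> S" "\<And>y. y \<in> S \<Longrightarrow> u y = v y"
  shows "partial_deriv i u x = partial_deriv i v x"
  unfolding partial_deriv_def
  using frechet_derivative_transform_within_open[OF assms] by simp

lemma partial_deriv_uminus:
  "u differentiable at x \<Longrightarrow> partial_deriv i (\<lambda>x. - u x) x = - partial_deriv i u x"
  by (rule partial_deriv_eqI[THEN trans, OF has_derivative_minus])
    (auto simp: partial_deriv_def frechet_derivative_works)

definition viscosity_operator :: "real \<Rightarrow> real \<Rightarrow> (real^'n \<Rightarrow> real) \<Rightarrow> real^'n \<Rightarrow> real" where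
  "viscosity_operator p q \<phi> y =
    - (norm (gradient \<phi> y) powr (q - 2) * normalized_p_laplacian p \<phi> y)"

lemma C2_uminus:
  assumes "C2_near \<phi> x0"
  shows "C2_near (\<lambda>x. - \<phi> x) x0"
    and "\<forall>\<^sub>F x in at x0. gradient (\<lambda>x. - \<phi> x) x = - gradient \<phi> x"
    and "\<forall>\<^sub>F x in at x0. viscosity_operator p q (\<lambda>x. - \<phi> x) x = - viscosity_operator p q \<phi> x"
proof -
  obtain U where U: "open U" "x0 \<in> U" "\<phi> differentiable_on U"
    "\<And>i. partial_deriv i \<phi> differentiable_on U"
    "\<And>i j. continuous_on U (partial_deriv i (partial_deriv j \<phi>))"
    using assms unfolding C2_near_def by blast
  have d: "\<phi> differentiable at x" "partial_deriv i \<phi> differentiable at x" if "x \<in> U" for x i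
    using U that by (auto simp: differentiable_on_eq_differentiable_at)
  have p1: "partial_deriv i (\<lambda>x. - \<phi> x) x = - partial_deriv i \<phi> x" if "x \<in> U" for x i
    using d that by (simp add: partial_deriv_uminus)
  have p2: "partial_deriv i (partial_deriv j (\<lambda>x. - \<phi> x)) x = - partial_deriv i (partial_deriv j \<phi>) x"
    if "x \<in> U" for x i j
  proof -
    \<comment> \<open>The first derivatives agree on the whole open set \<open>U\<close>, so they
      may be differentiated once more.\<close>
    have "partial_deriv i (\<lambda>x. - partial_deriv j \<phi> x) x = partial_deriv i (partial_deriv j (\<lambda>x. - \<phi> x)) x"
      by (rule partial_deriv_transform_within_open[OF _ U(1) that])
        (auto simp: p1 d that)
    then show ?thesis using d that by (simp add: partial_deriv_uminus)
  qed
  have dm: "(\<lambda>x. - \<phi> x) differentiable_on U" using U(3) by (simp add: differentiable_on_def)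
  have pm: "partial_deriv i (\<lambda>x. - \<phi> x) differentiable_on U" for i
    unfolding differentiable_on_def
  proof
    fix x assume "x \<in> U"
    then have "(\<lambda>x. - partial_deriv i \<phi> x) differentiable at x within U"
      using U(4) by (simp add: differentiable_on_def)
    then show "partial_deriv i (\<lambda>x. - \<phi> x) differentiable at x within U"
      by (rule differentiable_transform_within[OF _ zero_less_one]) (use \<open>x \<in> U\<close> p1 in auto)
  qed
  have cm: "continuous_on U (partial_deriv i (partial_deriv j (\<lambda>x. - \<phi> x)))" for i j
  proof -
    have "continuous_on U (\<lambda>x. - partial_deriv i (partial_deriv j \<phi>) x)"
      using U(5) by (intro continuous_intros)
    then show ?thesis by (rule continuous_on_eq) (simp add: p2)
  qed
  show "C2_near (\<lambda>x. - \<phi> x) x0"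
    unfolding C2_near_def using U(1,2) dm pm cm by blast
  have g: "gradient (\<lambda>x. - \<phi> x) x = - gradient \<phi> x" if "x \<in> U" for x
    using p1 that by (simp add: gradient_def vec_eq_iff)
  have ev: "\<forall>\<^sub>F x in at x0. x \<in> U" using U by (simp add: eventually_at_topological) blast
  show "\<forall>\<^sub>F x in at x0. gradient (\<lambda>x. - \<phi> x) x = - gradient \<phi> x"
    using ev by eventually_elim (rule g)
  show "\<forall>\<^sub>F x in at x0. viscosity_operator p q (\<lambda>x. - \<phi> x) x = - viscosity_operator p q \<phi> x"
    using ev
  proof eventually_elim
    case (elim x)
    have "normalized_p_laplacian p (\<lambda>x. - \<phi> x) x = - normalized_p_laplacian p \<phi> x"
      using elim by (simp add: normalized_p_laplacian_def laplacian_def g p1 p2 sum_negf)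
    then show ?case using elim by (simp add: viscosity_operator_def g)
  qed
qed

text \<open>The operator is odd in the test function, and negation exchanges touching from below
  with touching from above and the upper limit with the lower one. All test arguments are therefore
  carried out for subsolutions only and applied to both \<open>u\<close> and
  \<open>- u\<close>.\<close>

lemma viscosity_supersolution_uminus:
  assumes "viscosity_supersolution p q f R u"
  shows "viscosity_subsolution p q (\<lambda>r. - f r) R (\<lambda>x. - u x)"
  unfolding viscosity_subsolution_def
proof (intro conjI ballI allI impI)
  show "bounded ((\<lambda>x. - u x) ` ball 0 R)"
    using assms bounded_uminus[of "u ` ball 0 R"]
    by (simp add: viscosity_supersolution_def image_image)
  show "upper_semicontinuous_on (ball 0 R) (\<lambda>x. - u x)"
    unfolding upper_semicontinuous_on_def
  proof (intro ballI allI impI)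
    fix x c assume "x \<in> ball 0 R" "- u x < c"
    then have "\<forall>\<^sub>F y in at x within ball 0 R. - c < u y"
      using assms by (simp add: viscosity_supersolution_def lower_semicontinuous_on_def)
    then show "\<forall>\<^sub>F y in at x within ball 0 R. - u y < c" by eventually_elim simp
  qed
next
  fix x0 \<phi>
  assume x0: "x0 \<in> ball 0 R" and h: "C2_near \<phi> x0 \<and> touches_from_above \<phi> (\<lambda>x. - u x) x0
    \<and> (\<forall>\<^sub>F x in at x0. gradient \<phi> x \<noteq> 0)"
  have "C2_near (\<lambda>x. - \<phi> x) x0" using h C2_uminus(1) by blast
  moreover have "touches_from_below (\<lambda>x. - \<phi> x) u x0"
  proof -
    have "\<forall>\<^sub>F x in at x0. - u x < \<phi> x" using h by (simp add: touches_from_above_def)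
    then have "\<forall>\<^sub>F x in at x0. - \<phi> x < u x" by eventually_elim simp
    then show ?thesis using h by (simp add: touches_from_below_def touches_from_above_def)
  qed
  moreover have "\<forall>\<^sub>F x in at x0. gradient (\<lambda>x. - \<phi> x) x \<noteq> 0"
  proof -
    have "\<forall>\<^sub>F x in at x0. gradient (\<lambda>x. - \<phi> x) x = - gradient \<phi> x"
      "\<forall>\<^sub>F x in at x0. gradient \<phi> x \<noteq> 0"
      using C2_uminus(2) h by blast+
    then show ?thesis by eventually_elim simp
  qed
  ultimately have *: "Limsup (at x0) (\<lambda>y. ereal (viscosity_operator p q (\<lambda>x. - \<phi> x) y))
      - ereal (f (norm x0)) \<ge> 0"
    using assms x0 unfolding viscosity_supersolution_def viscosity_operator_def by blast
  have "Limsup (at x0) (\<lambda>y. ereal (viscosity_operator p q (\<lambda>x. - \<phi> x) y))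
      = Limsup (at x0) (\<lambda>y. - ereal (viscosity_operator p q \<phi> y))"
  proof (rule Limsup_eq)
    have "\<forall>\<^sub>F y in at x0. viscosity_operator p q (\<lambda>x. - \<phi> x) y = - viscosity_operator p q \<phi> y"
      using C2_uminus(3) h by blast
    then show "\<forall>\<^sub>F y in at x0. ereal (viscosity_operator p q (\<lambda>x. - \<phi> x) y)
        = - ereal (viscosity_operator p q \<phi> y)"
      by eventually_elim simp
  qed
  also have "\<dots> = - Liminf (at x0) (\<lambda>y. ereal (viscosity_operator p q \<phi> y))"
    by (rule ereal_Limsup_uminus)
  finally have "Liminf (at x0) (\<lambda>y. ereal (viscosity_operator p q \<phi> y)) - ereal (- f (norm x0)) \<le> 0"
    using * by (cases "Liminf (at x0) (\<lambda>y. ereal (viscosity_operator p q \<phi> y))") auto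
  then show "Liminf (at x0) (\<lambda>y. ereal (- (norm (gradient \<phi> y) powr (q - 2) *
          normalized_p_laplacian p \<phi> y))) - ereal (- f (norm x0)) \<le> 0"
    unfolding viscosity_operator_def .
qed

section \<open>Gradient and Hessian of test functions\<close>

text \<open>A test function is handled through its gradient field \<open>G\<close> and its Hessian
  \<open>H x\<close> as a linear map. The Laplacian is the trace of \<open>H x\<close>, and
  expanding \<open>G x\<close> in the standard basis turns the double sum into the quadratic form of
  \<open>H x\<close> in direction \<open>G x\<close>.\<close>

lemma gradient_test:
  assumes S: "open S"
    and d1': "\<forall>x\<in>S. (\<phi> has_derivative (\<lambda>h. G x \<bullet> h)) (at x)"
    and d2': "\<forall>x\<in>S. (G has_derivative H x) (at x)"
    and c: "\<And>h. continuous_on S (\<lambda>x. H x h)"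
    and x: "x \<in> S"
  shows "C2_near \<phi> x" and "gradient \<phi> x = G x"
    and "normalized_p_laplacian p \<phi> x =
      (\<Sum>i\<in>UNIV. H x (axis i 1) $ i) + (p - 2) / (norm (G x))\<^sup>2 * (H x (G x) \<bullet> G x)"
proof -
  note d1 = bspec[OF d1'] and d2 = bspec[OF d2']
  have p1: "partial_deriv i \<phi> x = G x $ i" if "x \<in> S" for i x
    using partial_deriv_eqI[OF d1[OF that]] by (simp add: inner_axis)
  have d2c: "((\<lambda>x. G x $ j) has_derivative (\<lambda>h. H x h $ j)) (at x)" if "x \<in> S" for x j
    using bounded_linear.has_derivative[OF bounded_linear_vec_nth d2[OF that]] .
  have d3: "(partial_deriv j \<phi> has_derivative (\<lambda>h. H x h $ j)) (at x)" if "x \<in> S" for x j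
    by (rule has_derivative_transform_within_open[OF d2c[OF that] S that]) (simp add: p1)
  have p2: "partial_deriv i (partial_deriv j \<phi>) x = H x (axis i 1) $ j" if "x \<in> S" for i j x
    using partial_deriv_eqI[OF d3[OF that]] .
  show "C2_near \<phi> x" unfolding C2_near_def
  proof (intro exI conjI allI)
    show "open S" "x \<in> S" by fact+
    show "\<phi> differentiable_on S"
      using d1 S by (auto simp: differentiable_on_eq_differentiable_at differentiable_def)
    show "partial_deriv i \<phi> differentiable_on S" for i
      using d3 S by (auto simp: differentiable_on_eq_differentiable_at differentiable_def)
    show "continuous_on S (partial_deriv i (partial_deriv j \<phi>))" for i j
      by (rule continuous_on_eq[of _ "\<lambda>x. H x (axis i 1) $ j"])
        (auto simp: p2 intro!: continuous_intros c)
  qed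
  show g: "gradient \<phi> x = G x" using p1[OF x] by (simp add: gradient_def vec_eq_iff)
  have lin: "linear (H x)" using d2[OF x] by (simp add: has_derivative_linear)
  have "H x (G x) = H x (\<Sum>i\<in>UNIV. G x $ i *\<^sub>R axis i 1)"
    by (simp add: basis_expansion scalar_mult_eq_scaleR[symmetric])
  also have "\<dots> = (\<Sum>i\<in>UNIV. G x $ i *\<^sub>R H x (axis i 1))"
    by (simp add: linear_sum[OF lin] linear_scale[OF lin])
  finally have "H x (G x) \<bullet> G x = (\<Sum>i\<in>UNIV. \<Sum>j\<in>UNIV. H x (axis i 1) $ j * G x $ i * G x $ j)"
    by (simp add: inner_sum_left inner_vec_def[of "H x _"] sum_distrib_left mult_ac)
  then show "normalized_p_laplacian p \<phi> x =
      (\<Sum>i\<in>UNIV. H x (axis i 1) $ i) + (p - 2) / (norm (G x))\<^sup>2 * (H x (G x) \<bullet> G x)"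
    by (simp add: normalized_p_laplacian_def laplacian_def g p1[OF x] p2[OF x])
qed

text \<open>When the operator converges at \<open>x0\<close>, its lower limit is that limit, so
  extended reals disappear from the later arguments.\<close>

lemma subsolution_test:
  fixes u \<phi> :: "real^'n \<Rightarrow> real"
  assumes u: "viscosity_subsolution p q f R u" "x0 \<in> ball 0 R"
    and c: "C2_near \<phi> x0" and t: "touches_from_above \<phi> u x0"
    and g: "\<forall>\<^sub>F x in at x0. gradient \<phi> x \<noteq> 0"
    and l: "(viscosity_operator p q \<phi> \<longlongrightarrow> L) (at x0)"
  shows "L \<le> f (norm x0)"
proof -
  have "Liminf (at x0) (\<lambda>y. ereal (viscosity_operator p q \<phi> y)) = ereal L"
    by (rule lim_imp_Liminf) (use l in auto)
  moreover have "Liminf (at x0) (\<lambda>y. ereal (viscosity_operator p q \<phi> y)) - ereal (f (norm x0)) \<le> 0"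
    using u c t g unfolding viscosity_subsolution_def viscosity_operator_def by blast
  ultimately show ?thesis by simp
qed

text \<open>The quotient and the power in the operator are singular only at gradient zero; elsewhere
  the operator is a continuous function of the first and second derivatives. At a contact point with
  nonzero gradient it can simply be evaluated.\<close>

lemma C2_near_nonzero_gradient:
  fixes \<phi> :: "real^'n \<Rightarrow> real"
  assumes "C2_near \<phi> x0" and nz: "gradient \<phi> x0 \<noteq> 0"
  shows "\<forall>\<^sub>F x in at x0. gradient \<phi> x \<noteq> 0"
    and "(viscosity_operator p q \<phi> \<longlongrightarrow> viscosity_operator p q \<phi> x0) (at x0)"
proof -
  obtain U where U: "open U" "x0 \<in> U" "\<phi> differentiable_on U"
    "\<And>i. partial_deriv i \<phi> differentiable_on U"
    "\<And>i j. continuous_on U (partial_deriv i (partial_deriv j \<phi>))"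
    using assms unfolding C2_near_def by blast
  have 1: "(partial_deriv i \<phi> \<longlongrightarrow> partial_deriv i \<phi> x0) (at x0)" for i
    using differentiable_imp_continuous_on[OF U(4)] U(1,2)
    by (metis continuous_on_eq_continuous_at isContD)
  have 2: "(partial_deriv i (partial_deriv j \<phi>) \<longlongrightarrow> partial_deriv i (partial_deriv j \<phi>) x0) (at x0)" for i j
    using U(1,2,5) by (metis continuous_on_eq_continuous_at isContD)
  have 3: "(gradient \<phi> \<longlongrightarrow> gradient \<phi> x0) (at x0)"
    unfolding gradient_def by (intro vec_tendstoI) (simp add: 1)
  show "\<forall>\<^sub>F x in at x0. gradient \<phi> x \<noteq> 0"
    using tendsto_imp_eventually_ne[OF 3 nz] .
  show "(viscosity_operator p q \<phi> \<longlongrightarrow> viscosity_operator p q \<phi> x0) (at x0)"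
    unfolding viscosity_operator_def normalized_p_laplacian_def laplacian_def
    by (intro tendsto_intros 1 2 3) (use nz in auto)
qed

text \<open>The squared distance is a polynomial, so the chain rule also works at the centre
  \<open>z\<close>. The Hessian is a multiple of the identity plus a rank-one term along
  \<open>x - z\<close>. The open set \<open>T\<close> leaves room for profiles that are smooth only
  away from the centre.\<close>

lemma has_derivative_quadratic_composition:
  fixes z :: "'a::euclidean_space"
  assumes T: "open T"
    and b1: "\<forall>t\<in>T. (b has_real_derivative b' t) (at t)"
    and b2: "\<forall>t\<in>T. (b' has_real_derivative b'' t) (at t)"
    and c: "continuous_on T b''"
  defines "S \<equiv> {x. (x - z) \<bullet> (x - z) \<in> T}"
  defines "G \<equiv> \<lambda>x. (2 * b' ((x - z) \<bullet> (x - z))) *\<^sub>R (x - z)"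
  defines "H \<equiv> \<lambda>x h. (2 * b' ((x - z) \<bullet> (x - z))) *\<^sub>R h
      + (4 * b'' ((x - z) \<bullet> (x - z)) * ((x - z) \<bullet> h)) *\<^sub>R (x - z)"
  shows "open S"
    and "\<forall>x\<in>S. ((\<lambda>x. b ((x - z) \<bullet> (x - z))) has_derivative (\<lambda>h. G x \<bullet> h)) (at x)"
    and "\<forall>x\<in>S. (G has_derivative H x) (at x)"
    and "\<And>h. continuous_on S (\<lambda>x. H x h)"
proof -
  let ?s = "\<lambda>x. (x - z) \<bullet> (x - z)"
  have "S = ?s -` T" by (auto simp: S_def)
  moreover have cs: "continuous_on A ?s" for A by (intro continuous_intros)
  ultimately show "open S" using T by (simp add: open_vimage)
  have s: "(?s has_derivative (\<lambda>h. 2 * ((x - z) \<bullet> h))) (at x)" for x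
    by (auto intro!: derivative_eq_intros simp: inner_commute)
  have B: "((\<lambda>x. b (?s x)) has_derivative (\<lambda>h. b' (?s x) * (2 * ((x - z) \<bullet> h)))) (at x)"
    "((\<lambda>x. b' (?s x)) has_derivative (\<lambda>h. b'' (?s x) * (2 * ((x - z) \<bullet> h)))) (at x)"
    if "x \<in> S" for x
    using has_derivative_compose[OF s, of b "(*) (b' (?s x))"]
      has_derivative_compose[OF s, of b' "(*) (b'' (?s x))"] b1 b2 that
    by (auto simp: S_def has_field_derivative_def)
  show "\<forall>x\<in>S. ((\<lambda>x. b (?s x)) has_derivative (\<lambda>h. G x \<bullet> h)) (at x)"
    using B(1) by (simp add: G_def mult_ac)
  show "\<forall>x\<in>S. (G has_derivative H x) (at x)"
  proof
    fix x assume "x \<in> S"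
    show "(G has_derivative H x) (at x)"
      unfolding G_def H_def
      by (rule derivative_eq_intros B(2) \<open>x \<in> S\<close> refl)+ (auto simp: algebra_simps)
  qed
  have "continuous_on T b'"
    using b2 DERIV_continuous_on has_field_derivative_at_within by blast
  then have "continuous_on S (\<lambda>x. b'' (?s x))" "continuous_on S (\<lambda>x. b' (?s x))"
    by (auto intro!: continuous_on_compose2[OF _ cs] c simp: S_def)
  then show "continuous_on S (\<lambda>x. H x h)" for h
    unfolding H_def by (intro continuous_intros)
qed

text \<open>The vector \<open>w\<close>, and hence its multiple \<open>v\<close>, is an eigenvector
  of \<open>H\<close> with eigenvalue \<open>l + m * (w \<bullet> w)\<close>; the normalized
  quadratic form is this eigenvalue.\<close>

lemma normalized_p_laplacian_rank_one:
  fixes w :: "real^'n"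
  assumes "H = (\<lambda>h. l *\<^sub>R h + (m * (w \<bullet> h)) *\<^sub>R w)" and "v = c *\<^sub>R w" and "v \<noteq> 0"
  shows "(\<Sum>i\<in>UNIV. H (axis i 1) $ i) + (p - 2) / (norm v)\<^sup>2 * (H v \<bullet> v)
    = real (CARD('n)) * l + m * (w \<bullet> w) + (p - 2) * (l + m * (w \<bullet> w))"
proof -
  have "(\<Sum>i\<in>UNIV. H (axis i 1) $ i) = (\<Sum>i\<in>(UNIV::'n set). l + m * (w $ i * w $ i))"
    by (simp add: assms(1) inner_axis mult.assoc)
  also have "\<dots> = real (CARD('n)) * l + m * (w \<bullet> w)"
    by (simp add: sum.distrib sum_distrib_left inner_vec_def)
  finally have 1: "(\<Sum>i\<in>UNIV. H (axis i 1) $ i) = real (CARD('n)) * l + m * (w \<bullet> w)" .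
  have "H v \<bullet> v = (l + m * (w \<bullet> w)) * (norm v)\<^sup>2"
    by (simp add: assms(1,2) power2_norm_eq_inner inner_add_left algebra_simps del: norm_scaleR)
  then show ?thesis using 1 assms(3) by simp
qed

lemma quadratic_composition_test:
  fixes z :: "real^'n"
  assumes b1: "\<And>t. (b has_real_derivative b' t) (at t)"
    and b2: "\<And>t. (b' has_real_derivative b'' t) (at t)"
    and c: "continuous_on UNIV b''"
  defines "\<phi> \<equiv> \<lambda>x. b ((x - z) \<bullet> (x - z))"
  shows "C2_near \<phi> x"
    and "gradient \<phi> x = (2 * b' ((x - z) \<bullet> (x - z))) *\<^sub>R (x - z)"
    and "gradient \<phi> x \<noteq> 0 \<Longrightarrow> normalized_p_laplacian p \<phi> x =
      real CARD('n) * (2 * b' ((x - z) \<bullet> (x - z))) + 4 * b'' ((x - z) \<bullet> (x - z)) * ((x - z) \<bullet> (x - z))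
      + (p - 2) * (2 * b' ((x - z) \<bullet> (x - z)) + 4 * b'' ((x - z) \<bullet> (x - z)) * ((x - z) \<bullet> (x - z)))"
proof -
  note d = has_derivative_quadratic_composition[where T = UNIV and z = z and b = b and b' = b',
      OF open_UNIV ballI[OF b1] ballI[OF b2] c]
  have S: "x \<in> {x. (x - z) \<bullet> (x - z) \<in> UNIV}" by simp
  note test = gradient_test[OF d S, folded \<phi>_def]
  show "C2_near \<phi> x" by (rule test(1))
  show g: "gradient \<phi> x = (2 * b' ((x - z) \<bullet> (x - z))) *\<^sub>R (x - z)" by (rule test(2))
  show "normalized_p_laplacian p \<phi> x =
      real CARD('n) * (2 * b' ((x - z) \<bullet> (x - z))) + 4 * b'' ((x - z) \<bullet> (x - z)) * ((x - z) \<bullet> (x - z))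
      + (p - 2) * (2 * b' ((x - z) \<bullet> (x - z)) + 4 * b'' ((x - z) \<bullet> (x - z)) * ((x - z) \<bullet> (x - z)))"
    if nz: "gradient \<phi> x \<noteq> 0"
  proof -
    define l m where "l = 2 * b' ((x - z) \<bullet> (x - z))" and "m = 4 * b'' ((x - z) \<bullet> (x - z))"
    have nz': "l *\<^sub>R (x - z) \<noteq> 0" using nz unfolding g l_def .
    show ?thesis
      using test(3)[of p] normalized_p_laplacian_rank_one[OF refl refl nz', of l m p]
      unfolding l_def m_def by simp
  qed
qed

section \<open>Even powers, paraboloids and radial test functions\<close>

text \<open>Adding a high even power of the distance to the constant gives strict contact with
  gradient zero only at \<open>x0\<close>. Used for \<open>u\<close> and \<open>- u\<close>, the two
  inequalities force \<open>f = 0\<close> where a radial solution is locally constant.\<close>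

lemma subsolution_locally_constant:
  fixes u :: "real^'n \<Rightarrow> real"
  assumes u: "viscosity_subsolution p q f R u" and x0: "x0 \<in> ball 0 R"
    and const: "\<forall>\<^sub>F x in at x0. u x = u x0" and q: "q > 1" and p: "p > 1"
  shows "0 \<le> f (norm x0)"
proof -
  \<comment> \<open>The test function is \<open>u x0 + \<bar>x - x0\<bar>\<^sup>2\<^sup>m\<close>; for large \<open>m\<close> its operator vanishes at \<open>x0\<close>
    even if \<open>q < 2\<close>.\<close>
  obtain m :: nat where m: "real m > 1 + 1 / (q - 1) + \<bar>q - 2\<bar> / (q - 1)"
    using reals_Archimedean2 by blast
  have m1: "real m > 1" using m q by (smt (verit) divide_nonneg_pos)
  have "(q - 1) * (real m - 1) > (q - 1) * (1 / (q - 1) + \<bar>q - 2\<bar> / (q - 1))"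
    using m q by (intro mult_strict_left_mono) auto
  moreover have "(q - 1) * (1 / (q - 1) + \<bar>q - 2\<bar> / (q - 1)) = 1 + \<bar>q - 2\<bar>"
    using q by (simp add: distrib_left)
  ultimately have mq: "(real m - 1) * (q - 1) > \<bar>q - 2\<bar>" by (simp add: mult.commute)
  \<comment> \<open>With \<open>s\<close> the squared distance, the gradient factor has order
    \<open>s\<close> to the \<open>(m - 1) * (q - 2) + (q - 2) / 2\<close> and the normalized
    p-Laplacian order \<open>s\<close> to the \<open>m - 1\<close>; the orders add up to
    \<open>e\<close>.\<close>
  define e where "e = (real m - 1) * (q - 1) + (q - 2) / 2"
  have e: "e > 0" using mq unfolding e_def by (simp add: abs_if field_simps split: if_splits)
  have b: "((\<lambda>t::real. u x0 + t ^ m) has_real_derivative m * t ^ (m - 1)) (at t)"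
    "((\<lambda>t::real. m * t ^ (m - 1)) has_real_derivative m * ((real m - 1) * t ^ (m - 2))) (at t)" for t :: real
    using m1 by (auto intro!: derivative_eq_intros simp: numeral_2_eq_2 of_nat_diff)
  have cb: "continuous_on UNIV (\<lambda>t::real. m * ((real m - 1) * t ^ (m - 2)))"
    by (intro continuous_intros)
  note test = quadratic_composition_test[OF b cb, where z = x0]
  define \<phi> where "\<phi> = (\<lambda>x. u x0 + ((x - x0) \<bullet> (x - x0)) ^ m)"
  define s where "s x = (x - x0) \<bullet> (x - x0)" for x
  define K where "K = real CARD('n) * 2 + 4 * (real m - 1) + (p - 2) * (2 + 4 * (real m - 1))"
  have s: "s x > 0" if "x \<noteq> x0" for x using that by (simp add: s_def)
  have gr: "gradient \<phi> x = (2 * (m * s x ^ (m - 1))) *\<^sub>R (x - x0)" for x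
    using test(2)[of x] by (simp add: \<phi>_def s_def)
  have gnz: "gradient \<phi> x \<noteq> 0" if "x \<noteq> x0" for x
    using that m1 s[OF that] by (simp add: gr)
  have lap: "normalized_p_laplacian p \<phi> x = K * (m * s x ^ (m - 1))" if "x \<noteq> x0" for x
  proof -
    have "normalized_p_laplacian p \<phi> x = real CARD('n) * (2 * (m * s x ^ (m - 1)))
        + 4 * (m * ((real m - 1) * s x ^ (m - 2))) * s x
        + (p - 2) * (2 * (m * s x ^ (m - 1)) + 4 * (m * ((real m - 1) * s x ^ (m - 2))) * s x)"
      using test(3)[of x p] gnz[OF that] unfolding \<phi>_def s_def by blast
    moreover have pw: "s x ^ (m - 1) = s x ^ (m - 2) * s x"
      using m1 power_Suc2[of "s x" "m - 2"] by (simp add: Suc_diff_le numeral_2_eq_2 Suc_diff_Suc)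
    ultimately show ?thesis unfolding K_def pw by (simp add: algebra_simps)
  qed
  have op: "viscosity_operator p q \<phi> x = - ((2 * m) powr (q - 2) * m * K) * s x powr e" if "x \<noteq> x0" for x
  proof -
    have n: "norm (gradient \<phi> x) = 2 * m * (s x powr (real m - 1) * s x powr (1/2))"
    proof -
      have "norm (x - x0) = s x powr (1/2)"
        using s[OF that] by (simp add: s_def norm_eq_sqrt_inner powr_half_sqrt)
      then show ?thesis
        using s[OF that] m1 by (simp add: gr abs_mult powr_realpow[symmetric] of_nat_diff)
    qed
    have "viscosity_operator p q \<phi> x = - ((2 * m * (s x powr (real m - 1) * s x powr (1/2))) powr (q - 2) * (K * (m * s x powr (real m - 1))))"
      using s[OF that] m1 by (simp add: viscosity_operator_def n lap[OF that] powr_realpow[symmetric] of_nat_diff)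
    also have "\<dots> = - ((2 * m) powr (q - 2) * m * K) * (s x powr ((real m - 1) * (q - 2)) * s x powr (1 / 2 * (q - 2)) * s x powr (real m - 1))"
      using s[OF that] m1 by (simp add: powr_mult powr_powr mult_ac)
    also have "\<dots> = - ((2 * m) powr (q - 2) * m * K) * s x powr e"
      by (simp add: powr_add[symmetric] e_def field_simps)
    finally show ?thesis .
  qed
  have lim: "(viscosity_operator p q \<phi> \<longlongrightarrow> 0) (at x0)"
  proof -
    have "((\<lambda>x. s x powr e) \<longlongrightarrow> s x0 powr e) (at x0)"
      unfolding s_def using e by (intro tendsto_intros) (auto intro!: always_eventually)
    then have "((\<lambda>x. - ((2 * m) powr (q - 2) * m * K) * s x powr e) \<longlongrightarrow> - ((2 * m) powr (q - 2) * m * K) * 0) (at x0)"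
      using e by (intro tendsto_mult tendsto_const) (simp add: s_def)
    then show ?thesis
      by (simp add: op cong: Lim_cong_within)
  qed
  have "touches_from_above \<phi> u x0" unfolding touches_from_above_def
  proof
    show "\<phi> x0 = u x0" using m1 by (simp add: \<phi>_def)
    have "\<forall>\<^sub>F x in at x0. x \<noteq> x0" by (simp add: eventually_at_filter)
    with const show "\<forall>\<^sub>F x in at x0. \<phi> x > u x"
      by eventually_elim (use s in \<open>simp add: \<phi>_def s_def\<close>)
  qed
  moreover have "C2_near \<phi> x0" using test(1) by (simp add: \<phi>_def)
  moreover have "\<forall>\<^sub>F x in at x0. gradient \<phi> x \<noteq> 0"
    using gnz by (simp add: eventually_at_filter)
  ultimately show ?thesis using subsolution_test[OF u x0 _ _ _ lim] by simp
qed

text \<open>Below a cone of slope 2 there is room for a unit gradient and, in addition, for any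
  amount of concavity. The gradient at the contact point is fixed, so the operator can be made
  larger than \<open>f 0\<close>.\<close>

lemma subsolution_origin:
  fixes u :: "real^'n \<Rightarrow> real"
  assumes u: "viscosity_subsolution p q f R u" and R: "R > 0" and p: "p > 1" and n: "CARD('n) \<ge> 2"
  shows "\<not> (\<forall>\<^sub>F x in at 0. u x \<le> u 0 - 2 * norm x)"
proof
  assume dec: "\<forall>\<^sub>F x in at 0. u x \<le> u 0 - 2 * norm x"
  \<comment> \<open>A paraboloid with leading coefficient \<open>- A\<close> has normalized
    p-Laplacian \<open>- (A * K)\<close>; the choice of \<open>A\<close> below makes
    \<open>A * K\<close> equal to \<open>\<bar>f 0\<bar> + 1\<close>.\<close>
  define K where "K = 2 * real CARD('n) + 2 * (p - 2)"
  have K: "K > 0" using n p by (simp add: K_def)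
  define A where "A = (\<bar>f 0\<bar> + 1) / K"
  have A: "A > 0" "A * K > f 0" using K by (auto simp: A_def)
  obtain k :: 'n where True by simp
  \<comment> \<open>The paraboloid below has vertex \<open>z\<close>, so that its gradient at the origin is the unit vector
    \<open>2 A z\<close>, however large \<open>A\<close> is.\<close>
  define z :: "real^'n" where "z = (1 / (2 * A)) *\<^sub>R axis k 1"
  have nz: "norm z = 1 / (2 * A)" using A by (simp add: z_def norm_axis_1)
  have b: "((\<lambda>t::real. u 0 - A * (t - z \<bullet> z)) has_real_derivative - A) (at t)"
    "((\<lambda>t::real. - A) has_real_derivative 0) (at t)" for t
    by (auto intro!: derivative_eq_intros)
  note test = quadratic_composition_test[OF b continuous_on_const, where z = z]
  define \<phi> where "\<phi> = (\<lambda>x. u 0 - A * ((x - z) \<bullet> (x - z) - z \<bullet> z))"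
  have C2: "C2_near \<phi> 0" using test(1) by (simp add: \<phi>_def)
  have gr: "gradient \<phi> 0 = (2 * A) *\<^sub>R z" using test(2)[of "0::real^'n"] by (simp add: \<phi>_def)
  have gnz: "gradient \<phi> 0 \<noteq> 0" using A by (auto simp: gr z_def axis_eq_0_iff)
  have "normalized_p_laplacian p \<phi> 0 = real CARD('n) * (- (2 * A)) + (p - 2) * (- (2 * A))"
    using test(3)[of "0::real^'n" p] gnz unfolding \<phi>_def by simp
  then have "normalized_p_laplacian p \<phi> 0 = - (A * K)" by (simp add: K_def algebra_simps)
  then have op: "viscosity_operator p q \<phi> 0 = A * K"
    using A by (simp add: viscosity_operator_def gr nz)
  have "touches_from_above \<phi> u 0" unfolding touches_from_above_def
  proof
    show "\<phi> 0 = u 0" by (simp add: \<phi>_def)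
    have "\<forall>\<^sub>F x in at 0. norm x < 1 / A \<and> x \<noteq> 0"
      using A unfolding eventually_at by (intro exI[of _ "1 / A"]) (auto simp: dist_norm)
    with dec show "\<forall>\<^sub>F x in at 0. \<phi> x > u x"
    proof eventually_elim
      case (elim x)
      have "\<phi> x = u 0 - A * (norm x)\<^sup>2 + 2 * A * (x \<bullet> z)"
        by (simp add: \<phi>_def inner_diff_left inner_diff_right inner_commute power2_norm_eq_inner algebra_simps)
      \<comment> \<open>The linear term lowers the paraboloid by at most \<open>norm x\<close> and,
        within radius \<open>1 / A\<close>, the quadratic term by less than \<open>norm x\<close>.
        Together this stays above the cone in \<open>dec\<close>.\<close>
      moreover have "\<bar>x \<bullet> z\<bar> \<le> norm x * norm z" by (rule Cauchy_Schwarz_ineq2)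
      then have "2 * A * (x \<bullet> z) \<ge> - norm x" using A by (simp add: nz field_simps abs_le_iff)
      moreover have "norm x * (A * norm x) < norm x * 1"
        using elim A by (intro mult_strict_left_mono) (auto simp: field_simps)
      then have "A * (norm x)\<^sup>2 < norm x" by (simp add: power2_eq_square mult_ac)
      ultimately show ?case using elim by linarith
    qed
  qed
  then have "viscosity_operator p q \<phi> 0 \<le> f (norm (0::real^'n))"
    using subsolution_test[OF u _ C2] C2_near_nonzero_gradient[OF C2 gnz] R by auto
  then show False using A op by simp
qed

text \<open>The Hessian of a radial function has eigenvalue \<open>g''\<close> in the radial
  direction and \<open>g' / r\<close> in the tangential ones, which gives the one-dimensional
  operator. The weak inequality \<open>U \<le> g\<close> is enough, since strictness is supplied by
  a correction in the proof.\<close>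

lemma subsolution_radial_test:
  fixes u :: "real^'n \<Rightarrow> real"
  assumes u: "viscosity_subsolution p q f R u"
    and U: "\<And>x. x \<in> ball 0 R \<Longrightarrow> u x = U (norm x)"
    and T: "open T" "r0 \<in> T" "T \<subseteq> {0<..<R}"
    and g1: "\<And>r. r \<in> T \<Longrightarrow> (g has_real_derivative g' r) (at r)"
    and g2: "\<And>r. r \<in> T \<Longrightarrow> (g' has_real_derivative g'' r) (at r)"
    and c: "continuous_on T g''"
    and touch: "g r0 = U r0" "\<And>r. r \<in> T \<Longrightarrow> U r \<le> g r"
    and nz: "g' r0 \<noteq> 0"
  shows "- (\<bar>g' r0\<bar> powr (q - 2) * ((p - 1) * g'' r0 + (real CARD('n) - 1) / r0 * g' r0)) \<le> f r0"
proof -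
  have r0: "0 < r0" "r0 < R" using T by auto
  obtain k :: 'n where True by simp
  define x0 :: "real^'n" where "x0 = r0 *\<^sub>R axis k 1"
  have nx0: "norm x0 = r0" "x0 \<bullet> x0 = r0\<^sup>2"
    using r0 by (simp_all add: x0_def norm_axis_1 inner_axis_axis power2_eq_square)
  define T2 where "T2 = {0<..} \<inter> sqrt -` T"
  have T2: "open T2"
    unfolding T2_def by (intro open_Int open_greaterThan open_vimage T continuous_intros)
  \<comment> \<open>\<open>a'\<close> and \<open>a''\<close> are the first two derivatives of
    \<open>g (sqrt t)\<close>, the profile in terms of the squared norm.\<close>
  define a' where "a' = (\<lambda>t. g' (sqrt t) / (2 * sqrt t))"
  define a'' where "a'' = (\<lambda>t. g'' (sqrt t) / (4 * t) - g' (sqrt t) / (4 * t * sqrt t))"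
  have sq: "((\<lambda>t. h (sqrt t)) has_real_derivative h' (sqrt t) / (2 * sqrt t)) (at t)"
    if "t \<in> T2" and "\<And>r. r \<in> T \<Longrightarrow> (h has_real_derivative h' r) (at r)" for t h h'
  proof -
    have t: "0 < t" "sqrt t \<in> T" using that(1) by (auto simp: T2_def)
    show ?thesis
      by (rule DERIV_cong[OF DERIV_chain2[OF that(2)[OF t(2)] DERIV_real_sqrt[OF t(1)]]])
        (simp add: field_simps)
  qed
  have A1: "((\<lambda>t. g (sqrt t)) has_real_derivative a' t) (at t)" if "t \<in> T2" for t
    unfolding a'_def by (rule sq[OF that]) (rule g1)
  have A2: "(a' has_real_derivative a'' t) (at t)" if "t \<in> T2" for t
  proof -
    define s where "s = sqrt t"
    have s: "s > 0" "t = s * s" using that by (auto simp: s_def T2_def)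
    have "((\<lambda>t. 2 * sqrt t) has_real_derivative 2 * (inverse s / 2)) (at t)"
      unfolding s_def by (intro DERIV_cmult DERIV_real_sqrt) (use that in \<open>simp add: T2_def\<close>)
    note d = DERIV_divide[OF sq[of t g' g'', OF that g2] this]
    have e: "(g'' s / (2 * s) * (2 * s) - g' s * (2 * (inverse s / 2))) / (2 * s * (2 * s))
        = g'' s / (4 * (s * s)) - g' s / (4 * (s * s) * s)"
      using s(1) by (simp add: field_simps)
    show ?thesis
      unfolding a'_def a''_def
      by (rule DERIV_cong[OF d]) (use s(1) e in \<open>simp_all add: s_def\<close>)
  qed
  have "continuous_on T g'"
    using g2 DERIV_continuous_on has_field_derivative_at_within by blast
  then have A3: "continuous_on T2 a''" unfolding a''_def T2_def
    by (auto intro!: continuous_intros continuous_on_compose2[OF c] continuous_on_compose2[of T g'])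
  define S where "S = {x::real^'n. (x - 0) \<bullet> (x - 0) \<in> T2}"
  note dA = has_derivative_quadratic_composition[OF T2 ballI[OF A1] ballI[OF A2] A3, where z = "0::real^'n", folded S_def]
  have b: "((\<lambda>t::real. t\<^sup>2) has_real_derivative 2 * t) (at t)"
    "((\<lambda>t::real. 2 * t) has_real_derivative 2) (at t)" for t
    by (auto intro!: derivative_eq_intros)
  note dB = has_derivative_quadratic_composition[where T = UNIV and z = x0,
      OF open_UNIV ballI[OF b(1)] ballI[OF b(2)] continuous_on_const]
  \<comment> \<open>The quartic term makes the contact strict across the sphere and does not change
    derivatives up to order two at \<open>x0\<close>.\<close>
  define \<phi> where "\<phi> = (\<lambda>x::real^'n. g (sqrt (x \<bullet> x)) + ((x - x0) \<bullet> (x - x0))\<^sup>2)"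
  define G where "G = (\<lambda>x. (2 * a' (x \<bullet> x)) *\<^sub>R x + (4 * ((x - x0) \<bullet> (x - x0))) *\<^sub>R (x - x0))"
  define H where "H = (\<lambda>x h. ((2 * a' (x \<bullet> x)) *\<^sub>R h + (4 * a'' (x \<bullet> x) * (x \<bullet> h)) *\<^sub>R x) +
    ((4 * ((x - x0) \<bullet> (x - x0))) *\<^sub>R h + (8 * ((x - x0) \<bullet> h)) *\<^sub>R (x - x0)))"
  have "x0 \<noteq> 0" using nx0(1) r0(1) by auto
  then have xS: "x0 \<in> S" using T r0 by (auto simp: S_def T2_def nx0)
  have D1: "(\<phi> has_derivative (\<lambda>h. G x \<bullet> h)) (at x)" if "x \<in> S" for x
    using has_derivative_add[OF bspec[OF dA(2) that] bspec[OF dB(2), of x]]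
    unfolding \<phi>_def G_def by (simp add: inner_add_left)
  have D2: "(G has_derivative H x) (at x)" if "x \<in> S" for x
    using has_derivative_add[OF bspec[OF dA(3) that] bspec[OF dB(3), of x]]
    unfolding G_def H_def by simp
  have D3: "continuous_on S (\<lambda>x. H x h)" for h
    using continuous_on_add[OF dA(4)[of h] continuous_on_subset[OF dB(4)[of h]]]
    unfolding H_def by simp
  note test = gradient_test[OF dA(1) ballI[OF D1] ballI[OF D2] D3 xS]
  have Gx: "gradient \<phi> x0 = (2 * a' (r0\<^sup>2)) *\<^sub>R x0"
    using test(2) by (simp add: G_def nx0)
  have a0: "a' (r0\<^sup>2) = g' r0 / (2 * r0)" "a'' (r0\<^sup>2) = g'' r0 / (4 * r0\<^sup>2) - g' r0 / (4 * r0\<^sup>2 * r0)"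
    using r0 by (simp_all add: a'_def a''_def)
  have gnz: "gradient \<phi> x0 \<noteq> 0" using r0 nz nx0 by (auto simp: Gx a0)
  have ng: "norm (gradient \<phi> x0) = \<bar>g' r0\<bar>" using r0 by (simp add: Gx nx0 a0 abs_mult)
  have Gx': "G x0 = (2 * a' (r0\<^sup>2)) *\<^sub>R x0" "G x0 \<noteq> 0" using test(2) Gx gnz by auto
  have "normalized_p_laplacian p \<phi> x0 = real CARD('n) * (2 * a' (r0\<^sup>2)) + (4 * a'' (r0\<^sup>2)) * (x0 \<bullet> x0)
      + (p - 2) * ((2 * a' (r0\<^sup>2)) + (4 * a'' (r0\<^sup>2)) * (x0 \<bullet> x0))"
  proof -
    have "H x0 = (\<lambda>h. (2 * a' (r0\<^sup>2)) *\<^sub>R h + (4 * a'' (r0\<^sup>2) * (x0 \<bullet> h)) *\<^sub>R x0)"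
      by (simp add: H_def nx0 fun_eq_iff)
    from normalized_p_laplacian_rank_one[OF this Gx', of p] show ?thesis
      using test(3)[of p] by simp
  qed
  \<comment> \<open>Here \<open>2 * a'\<close> is the tangential eigenvalue
    \<open>g' r0 / r0\<close>, and adding \<open>4 * a''\<close> times the squared radius gives the
    radial one, \<open>g'' r0\<close>.\<close>
  also have "\<dots> = (p - 1) * g'' r0 + (real CARD('n) - 1) / r0 * g' r0"
    unfolding a0 nx0 using r0 by (simp add: field_simps power2_eq_square)
  finally have op: "viscosity_operator p q \<phi> x0 =
     - (\<bar>g' r0\<bar> powr (q - 2) * ((p - 1) * g'' r0 + (real CARD('n) - 1) / r0 * g' r0))"
    by (simp add: viscosity_operator_def ng)
  have "touches_from_above \<phi> u x0" unfolding touches_from_above_def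
  proof
    show "\<phi> x0 = u x0" using touch r0 U[of x0] by (simp add: \<phi>_def nx0)
    have "\<forall>\<^sub>F x in at x0. x \<in> S \<and> x \<noteq> x0"
      using dA(1) xS by (auto simp: eventually_at_topological)
    then show "\<forall>\<^sub>F x in at x0. \<phi> x > u x"
    proof eventually_elim
      case (elim x)
      have "sqrt (x \<bullet> x) = norm x" by (simp add: norm_eq_sqrt_inner)
      moreover have n: "norm x \<in> T" using elim by (simp add: S_def T2_def norm_eq_sqrt_inner)
      then have "u x \<le> g (norm x)" using U[of x] touch(2) T(3) by (auto simp: subset_eq)
      moreover have "((x - x0) \<bullet> (x - x0))\<^sup>2 > 0" using elim by simp
      moreover have "\<phi> x = g (norm x) + ((x - x0) \<bullet> (x - x0))\<^sup>2"
        by (simp add: \<phi>_def norm_eq_sqrt_inner)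
      ultimately show ?case by linarith
    qed
  qed
  then have "viscosity_operator p q \<phi> x0 \<le> f (norm x0)"
    using subsolution_test[OF u _ test(1)] C2_near_nonzero_gradient[OF test(1) gnz] r0
    by (auto simp: nx0)
  then show ?thesis by (simp add: op nx0)
qed

section \<open>The flux across its zeros\<close>

text \<open>The odd extension of a real power. Exponent \<open>q - 1\<close> passes from the
  weighted slope to the flux, and \<open>1 / (q - 1)\<close> passes back.\<close>

definition signed_power :: "real \<Rightarrow> real \<Rightarrow> real" where
  "signed_power s y = sgn s * \<bar>s\<bar> powr y"

lemma signed_power_simps [simp]:
  "signed_power 0 y = 0"
  "signed_power (- s) y = - signed_power s y"
  "signed_power s y = 0 \<longleftrightarrow> s = 0"
  by (auto simp: signed_power_def sgn_0_0)

lemma signed_power_pos: "s > 0 \<Longrightarrow> signed_power s y = s powr y"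
  by (simp add: signed_power_def)

lemma signed_power_signed_power: "a * b = 1 \<Longrightarrow> signed_power (signed_power s a) b = s"
  by (cases "s = 0") (auto simp: signed_power_def abs_mult sgn_mult powr_powr mult_sgn_abs abs_sgn_eq)

lemma tendsto_signed_power:
  "(f \<longlongrightarrow> l) F \<Longrightarrow> l \<noteq> 0 \<Longrightarrow> ((\<lambda>x. signed_power (f x) y) \<longlongrightarrow> signed_power l y) F"
  unfolding signed_power_def by (intro tendsto_intros) auto

text \<open>The flux \<open>P\<close> is only known to satisfy \<open>P' = - k\<close> where it does not vanish, and
  nothing is assumed about its continuity at its zeros. That the slope \<open>D\<close>, comparable to a
  power of \<open>P\<close>, is an actual derivative forces \<open>P\<close> to be continuous at the ends of the components
  of \<open>{P \<noteq> 0}\<close>. Near a point with \<open>k \<noteq> 0\<close> there is then at most one zero: two zeros would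
  enclose either a component of \<open>{P \<noteq> 0}\<close>, contradicting the mean value theorem, or an interval
  on which \<open>P = 0\<close>, contradicting \<open>flat\<close>.\<close>

locale degenerate_flux =
  fixes I :: "real set" and U D P m k K :: "real \<Rightarrow> real" and y :: real
  assumes I: "open I" "is_interval I"
    and dU: "\<And>r. r \<in> I \<Longrightarrow> (U has_real_derivative D r) (at r)"
    and D: "\<And>r. r \<in> I \<Longrightarrow> D r = m r * signed_power (P r) y"
    and m: "continuous_on I m" "\<And>r. r \<in> I \<Longrightarrow> m r > 0"
    and dP: "\<And>r. r \<in> I \<Longrightarrow> P r \<noteq> 0 \<Longrightarrow> (P has_real_derivative - k r) (at r)"
    and dK: "\<And>r. r \<in> I \<Longrightarrow> (K has_real_derivative k r) (at r)"
    and k: "continuous_on I k"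
    and flat: "\<And>r. r \<in> I \<Longrightarrow> \<forall>\<^sub>F s in nhds r. P s = 0 \<Longrightarrow> k r = 0"
begin

lemma between: "a \<in> I \<Longrightarrow> b \<in> I \<Longrightarrow> a \<le> x \<Longrightarrow> x \<le> b \<Longrightarrow> x \<in> I"
  using I(2) by (meson mem_is_interval_1_I)

text \<open>Let \<open>e\<close> be the largest zero of \<open>P\<close> up to \<open>r\<close>. To
  the right of \<open>e\<close> the sum \<open>P + K\<close> is constant, so \<open>P\<close> has a
  right limit at \<open>e\<close>. This limit is zero because a derivative cannot jump; the mean
  value theorem for \<open>K\<close> on the interval from \<open>e\<close> to \<open>r\<close> then
  gives \<open>x\<close>.\<close>

lemma last_zero:
  assumes "e0 \<in> I" "r \<in> I" "e0 < r" "P e0 = 0" "P r \<noteq> 0"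
  shows "\<exists>e x. e0 \<le> e \<and> e < x \<and> x < r \<and> P e = 0 \<and> P r = - k x * (r - e)"
proof -
  have inI: "x \<in> I" if "e0 \<le> x" "x \<le> r" for x using between that assms by blast
  define Z where "Z = {x \<in> {e0..r}. P x = 0}"
  \<comment> \<open>\<open>P\<close> is differentiable, hence continuous, at its nonzeros. This
    makes the zero set \<open>Z\<close> closed, although \<open>P\<close> may a priori jump at a
    zero.\<close>
  have nz_nbhd: "\<exists>T. open T \<and> x \<in> T \<and> (\<forall>y\<in>T. P y \<noteq> 0)" if "x \<in> {e0..r}" "P x \<noteq> 0" for x
  proof -
    have "isCont P x" using dP[of x] inI that DERIV_isCont by auto
    then have "\<forall>\<^sub>F y in nhds x. P y \<noteq> 0"
      using that(2) tendsto_imp_eventually_ne[of P "P x" "nhds x" 0]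
      by (simp add: continuous_at_imp_continuous_at_within isCont_def tendsto_at_iff_tendsto_nhds)
    then show ?thesis by (auto simp: eventually_nhds)
  qed
  have op: "\<exists>T. open T \<and> x \<in> T \<and> T \<inter> Z = {}" if "x \<notin> Z" for x
  proof (cases "x \<in> {e0..r}")
    case True then show ?thesis using that nz_nbhd[of x]
      by (fastforce simp: Z_def)
  next
    case False then show ?thesis by (intro exI[of _ "- {e0..r}"]) (auto simp: Z_def)
  qed
  have "closed Z" unfolding closed_def
  proof (rule Topological_Spaces.openI)
    fix x assume "x \<in> - Z"
    then obtain T where "open T" "x \<in> T" "T \<inter> Z = {}" using op[of x] by auto
    then show "\<exists>T. open T \<and> x \<in> T \<and> T \<subseteq> - Z" by (intro exI[of _ T]) auto
  qed
  moreover have "{e0..r} \<inter> Z = Z" by (auto simp: Z_def)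
  ultimately have "compact Z" using compact_Int_closed[OF compact_Icc, of Z e0 r] by simp
  moreover have "e0 \<in> Z" using assms by (simp add: Z_def)
  then have "Z \<noteq> {}" by blast
  ultimately obtain e where e: "e \<in> Z" "\<And>x. x \<in> Z \<Longrightarrow> x \<le> e"
    using compact_attains_sup[of Z] by blast
  have e': "e0 \<le> e" "e < r" "P e = 0" using e(1) assms by (auto simp: Z_def less_le)
  have nz: "P x \<noteq> 0" if "e < x" "x \<le> r" for x using e(2)[of x] that e' by (auto simp: Z_def)
  define C where "C = P r + K r"
  have PC: "P x = C - K x" if "e < x" "x \<le> r" for x
  proof (cases "x = r")
    case False
    have d: "((\<lambda>x. P x + K x) has_real_derivative 0) (at z)" if "x \<le> z" "z \<le> r" for z
      using DERIV_add[OF dP[of z] dK[of z]] nz[of z] inI[of z] that \<open>e < x\<close> e' by auto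
    have "P r + K r = P x + K x"
    proof (rule DERIV_isconst_end[of x r "\<lambda>x. P x + K x"])
      show "x < r" using False that by simp
      show "continuous_on {x..r} (\<lambda>x. P x + K x)"
        by (rule continuous_at_imp_continuous_on) (use DERIV_isCont[OF d] in auto)
      show "((\<lambda>x. P x + K x) has_real_derivative 0) (at z)" if "x < z" "z < r" for z
        using d that by simp
    qed
    then show ?thesis by (simp add: C_def)
  qed (simp add: C_def)
  have eI: "e \<in> I" using inI e' by simp
  have ev: "\<forall>\<^sub>F x in at_right e. e < x \<and> x < r"
    using e'(2) by (auto simp: eventually_at_right)
  \<comment> \<open>Otherwise \<open>D\<close> has a nonzero right limit at \<open>e\<close>. By
    L'Hopital's rule this limit is also the right derivative of \<open>U\<close> at
    \<open>e\<close>, which is \<open>D e = 0\<close>.\<close>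
  have Ce: "C - K e = 0"
  proof (rule ccontr)
    assume ne: "C - K e \<noteq> 0"
    have Kt: "(K \<longlongrightarrow> K e) (at_right e)"
      using DERIV_isCont[OF dK[OF eI]] by (simp add: isCont_def filterlim_at_split)
    have mt: "(m \<longlongrightarrow> m e) (at_right e)"
      using m(1) I(1) eI by (metis continuous_on_eq_continuous_at filterlim_at_split isCont_def)
    have "((\<lambda>x. m x * signed_power (C - K x) y) \<longlongrightarrow> m e * signed_power (C - K e) y) (at_right e)"
      by (intro tendsto_mult mt tendsto_signed_power tendsto_diff tendsto_const Kt ne)
    moreover have "\<forall>\<^sub>F x in at_right e. m x * signed_power (C - K x) y = D x"
      using ev by eventually_elim (use PC D inI e' in auto)
    ultimately have "(D \<longlongrightarrow> m e * signed_power (C - K e) y) (at_right e)"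
      by (rule Lim_transform_eventually)
    then have lim: "((\<lambda>x. D x / 1) \<longlongrightarrow> m e * signed_power (C - K e) y) (at_right e)" by simp
    have Uc: "((\<lambda>x. U x - U e) \<longlongrightarrow> 0) (at_right e)"
      using DERIV_isCont[OF dU[OF eI]] unfolding isCont_def filterlim_at_split
      by (auto simp: LIM_zero)
    have "((\<lambda>x. (U x - U e) / (x - e)) \<longlongrightarrow> m e * signed_power (C - K e) y) (at_right e)"
    proof (rule lhopital_right[OF Uc _ _ _ _ _ lim])
      show "((\<lambda>x. x - e) \<longlongrightarrow> 0) (at_right e)" by (auto intro!: tendsto_eq_intros)
      show "\<forall>\<^sub>F x in at_right e. x - e \<noteq> 0" using ev by eventually_elim simp
      show "\<forall>\<^sub>F x in at_right e. (1::real) \<noteq> 0" by simp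
      show "\<forall>\<^sub>F x in at_right e. ((\<lambda>x. U x - U e) has_real_derivative D x) (at x)"
        using ev by eventually_elim (use dU inI e' in \<open>auto intro!: derivative_eq_intros\<close>)
      show "\<forall>\<^sub>F x in at_right e. ((\<lambda>x. x - e) has_real_derivative 1) (at x)"
        by (auto intro!: derivative_eq_intros always_eventually)
    qed
    moreover have "((\<lambda>x. (U x - U e) / (x - e)) \<longlongrightarrow> D e) (at_right e)"
      using dU[OF eI] unfolding has_field_derivative_iff by (simp add: filterlim_at_split)
    ultimately have "D e = m e * signed_power (C - K e) y"
      by (metis tendsto_unique trivial_limit_at_right_real)
    moreover have "D e = 0" using D[OF eI] e' by simp
    ultimately show False using ne m(2)[OF eI] by simp
  qed
  have PC': "P x = C - K x" if "e \<le> x" "x \<le> r" for x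
    using PC[of x] Ce e'(3) that by (cases "x = e") auto
  obtain x where x: "e < x" "x < r" "K r - K e = (r - e) * k x"
    using MVT2[of e r K k] dK inI e' by fastforce
  have "P r = - k x * (r - e)" using PC'[of r] x e' Ce by (simp add: algebra_simps)
  then show ?thesis using x e' by blast
qed

text \<open>Reversing the line exchanges the last zero before a point with the first zero after it.
  \<open>P\<close> is negated along with \<open>D\<close>, so that the relation between them keeps
  its form with a positive \<open>m\<close>.\<close>

lemma reflect:
  "degenerate_flux (uminus ` I) (\<lambda>r. U (- r)) (\<lambda>r. - D (- r)) (\<lambda>r. - P (- r)) (\<lambda>r. m (- r))
    (\<lambda>r. k (- r)) (\<lambda>r. - K (- r)) y"
proof
  have mem: "r \<in> uminus ` I \<longleftrightarrow> - r \<in> I" for r by (metis (no_types) image_iff minus_minus)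
  have refl: "((\<lambda>r. h (- r)) has_real_derivative - d) (at r)"
    if "(h has_real_derivative d) (at (- r))" for h d r
    using DERIV_chain2[where f = h and g = uminus and Db = "- 1", OF that DERIV_minus[OF DERIV_ident]]
    by simp
  show "open (uminus ` I)" using I(1) by (rule open_negations)
  show "is_interval (uminus ` I)" using I(2) by (simp add: is_interval_uminus)
  fix r assume r: "r \<in> uminus ` I"
  then have r': "- r \<in> I" using mem by simp
  show "((\<lambda>r. U (- r)) has_real_derivative - D (- r)) (at r)" by (rule refl[OF dU[OF r']])
  show "- D (- r) = m (- r) * signed_power (- P (- r)) y" using D[OF r'] by simp
  show "0 < m (- r)" using m(2)[OF r'] .
  show "((\<lambda>r. - P (- r)) has_real_derivative - k (- r)) (at r)" if "- P (- r) \<noteq> 0"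
    using DERIV_minus[OF refl[OF dP[OF r']]] that by simp
  show "((\<lambda>r. - K (- r)) has_real_derivative k (- r)) (at r)"
    using DERIV_minus[OF refl[OF dK[OF r']]] by simp
  show "k (- r) = 0" if ev: "\<forall>\<^sub>F s in nhds r. - P (- s) = 0"
  proof (rule flat[OF r'])
    have "((\<lambda>x. - x) \<longlongrightarrow> - (- r)) (nhds (- r))" by (intro tendsto_minus filterlim_ident)
    then have "filterlim uminus (nhds r) (nhds (- r))" by simp
    from eventually_compose_filterlim[OF ev this]
    show "\<forall>\<^sub>F s in nhds (- r). P s = 0" by simp
  qed
next
  have neg: "uminus ` (uminus ` I) = I" by (simp add: image_image)
  show "continuous_on (uminus ` I) (\<lambda>r. m (- r))"
    using continuous_on_compose2[OF m(1), of "uminus ` I" uminus] neg by (simp add: continuous_on_minus)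
  show "continuous_on (uminus ` I) (\<lambda>r. k (- r))"
    using continuous_on_compose2[OF k, of "uminus ` I" uminus] neg by (simp add: continuous_on_minus)
qed

lemma first_zero:
  assumes "e0 \<in> I" "r \<in> I" "r < e0" "P e0 = 0" "P r \<noteq> 0"
  shows "\<exists>e x. e \<le> e0 \<and> x < e \<and> r < x \<and> P e = 0 \<and> P r = - k x * (r - e)"
proof -
  interpret R: degenerate_flux "uminus ` I" "\<lambda>r. U (- r)" "\<lambda>r. - D (- r)" "\<lambda>r. - P (- r)"
    "\<lambda>r. m (- r)" "\<lambda>r. k (- r)" "\<lambda>r. - K (- r)" y
    by (rule reflect)
  have "\<exists>e x. - e0 \<le> e \<and> e < x \<and> x < - r \<and> - P (- e) = 0 \<and> - P (- (- r)) = - k (- x) * (- r - e)"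
    by (rule R.last_zero) (use assms in auto)
  then obtain e x where "- e0 \<le> e" "e < x" "x < - r" "P (- e) = 0" "P r = k (- x) * (- r - e)"
    by auto
  then show ?thesis by (intro exI[of _ "- e"] exI[of _ "- x"]) (auto simp: algebra_simps)
qed

text \<open>At a zero \<open>r0\<close> of \<open>P\<close>, nearby values are
  \<open>- k x * (r - e)\<close> for a zero \<open>e\<close> between \<open>r0\<close> and
  \<open>r\<close>. If \<open>k r0 = 0\<close>, the difference quotient is at most
  \<open>\<bar>k x\<bar>\<close>, which is small. If \<open>k r0 \<noteq> 0\<close>, there is no
  other zero nearby, so \<open>e = r0\<close> and the quotient is exactly
  \<open>- k x\<close>.\<close>

lemma flux_derivative:
  assumes r0: "r0 \<in> I"
  shows "(P has_real_derivative - k r0) (at r0)"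
proof (cases "P r0 = 0")
  case False then show ?thesis using dP r0 by blast
next
  case True
  have isol: "(\<lambda>r. (P r - P r0) / (r - r0)) \<midarrow>r0\<rightarrow> - k r0"
  proof (rule LIM_I)
    fix \<epsilon> :: real assume \<epsilon>: "\<epsilon> > 0"
    \<comment> \<open>Tolerance at most \<open>\<bar>k r0\<bar>\<close> makes \<open>k\<close> keep
      the sign of \<open>k r0\<close> on the neighbourhood, if \<open>k r0\<close> is not
      zero.\<close>
    define \<eta> where "\<eta> = (if k r0 = 0 then \<epsilon> else min \<epsilon> \<bar>k r0\<bar>)"
    have \<eta>: "\<eta> > 0" "\<eta> \<le> \<epsilon>" using \<epsilon> by (auto simp: \<eta>_def)
    have "isCont k r0" using k I(1) r0 by (simp add: continuous_on_eq_continuous_at)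
    then obtain d1 where d1: "d1 > 0" "\<And>r. \<bar>r - r0\<bar> < d1 \<Longrightarrow> \<bar>k r - k r0\<bar> < \<eta>"
      using \<eta>(1) unfolding continuous_at_eps_delta dist_real_def by metis
    obtain d2 where d2: "d2 > 0" "ball r0 d2 \<subseteq> I" using I(1) r0 open_contains_ball by blast
    define d where "d = min d1 d2"
    have d: "d > 0" "r \<in> I" "\<bar>k r - k r0\<bar> < \<eta>" if "\<bar>r - r0\<bar> < d" for r
      using that d1 d2 by (auto simp: d_def dist_real_def)
    have d0: "d > 0" using d1 d2 by (simp add: d_def)
    have uniq: "z1 = z2" if z: "P z1 = 0" "P z2 = 0" "\<bar>z1 - r0\<bar> < d" "\<bar>z2 - r0\<bar> < d"
      and k0: "k r0 \<noteq> 0" for z1 z2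
    proof (rule ccontr)
      assume "z1 \<noteq> z2"
      then obtain a b where ab: "a < b" "P a = 0" "P b = 0" "\<bar>a - r0\<bar> < d" "\<bar>b - r0\<bar> < d"
        using z by (metis linorder_neqE_linordered_idom)
      have sg: "k x * k r0 > 0" if "\<bar>x - r0\<bar> < d" for x
        using d(3)[OF that] k0 by (auto simp: \<eta>_def zero_less_mult_iff abs_if split: if_splits)
      \<comment> \<open>A nonzero value would have a last zero before it and a first zero after it.
        As \<open>k\<close> has one sign, the two resulting formulas give \<open>P r\<close>
        opposite signs.\<close>
      have "P r = 0" if ar: "a < r" "r < b" for r
      proof (rule ccontr)
        assume nz: "P r \<noteq> 0"
        have r: "\<bar>r - r0\<bar> < d" using ar ab by auto
        obtain e x where 1: "a \<le> e" "e < x" "x < r" "P r = - k x * (r - e)"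
          using last_zero[OF d(2) d(2), of a r] ab r ar nz by blast
        obtain e' x' where 2: "e' \<le> b" "x' < e'" "r < x'" "P r = - k x' * (r - e')"
          using first_zero[OF d(2) d(2), of b r] ab r ar nz by blast
        have "k x * k r0 > 0" "k x' * k r0 > 0" using 1 2 ab ar by (auto intro!: sg)
        then have "(k x * k r0) * (r - e) > 0" "(k x' * k r0) * (r - e') < 0"
          using 1 2 by (auto intro!: mult_pos_pos mult_pos_neg)
        moreover have "(k x * k r0) * (r - e) = - P r * k r0" unfolding 1(4) by simp
        moreover have "(k x' * k r0) * (r - e') = - P r * k r0" unfolding 2(4) by simp
        ultimately show False by linarith
      qed
      then have z: "P s = 0" if "s \<in> {a<..<b}" for s using that by simp
      have "\<forall>\<^sub>F s in nhds ((a + b) / 2). s \<in> {a<..<b}"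
        by (rule eventually_nhds_in_open) (use ab(1) in auto)
      then have ev: "\<forall>\<^sub>F s in nhds ((a + b) / 2). P s = 0"
        by eventually_elim (rule z)
      have mid: "\<bar>(a + b) / 2 - r0\<bar> < d" using ab(4,5) by (auto simp: abs_less_iff field_simps)
      have "k ((a + b) / 2) = 0" by (rule flat[OF d(2)[OF mid] ev])
      then show False using sg[OF mid] by simp
    qed
    show "\<exists>s>0. \<forall>x. x \<noteq> r0 \<and> norm (x - r0) < s \<longrightarrow> norm ((P x - P r0) / (x - r0) - - k r0) < \<epsilon>"
    proof (intro exI[of _ d] conjI allI impI d0)
      fix r assume r: "r \<noteq> r0 \<and> norm (r - r0) < d"
      then have rd: "\<bar>r - r0\<bar> < d" by simp
      \<comment> \<open>If \<open>P r = 0\<close> and \<open>k r0 = 0\<close>, the choice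
        \<open>e = r\<close> works with \<open>x = r0\<close>; otherwise \<open>e\<close> is the
        nearest zero on the side of \<open>r0\<close>.\<close>
      have "\<exists>e x. P r = - k x * (r - e) \<and> \<bar>r - e\<bar> \<le> \<bar>r - r0\<bar> \<and> \<bar>x - r0\<bar> < d \<and> (k r0 \<noteq> 0 \<longrightarrow> e = r0)"
      proof (cases "P r = 0")
        case True
        show ?thesis
        proof (cases "k r0 = 0")
          case True
          then show ?thesis using \<open>P r = 0\<close> d0 by (intro exI[of _ r] exI[of _ r0]) auto
        next
          case False
          then show ?thesis using uniq[of r r0] r \<open>P r = 0\<close> \<open>P r0 = 0\<close> d0 by auto
        qed
      next
        case False
        show ?thesis
        proof (cases "r0 < r")
          case True
          obtain e x where 1: "r0 \<le> e" "e < x" "x < r" "P e = 0" "P r = - k x * (r - e)"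
            using last_zero[OF r0 d(2), of r] rd True \<open>P r \<noteq> 0\<close> \<open>P r0 = 0\<close> by blast
          then have "k r0 \<noteq> 0 \<longrightarrow> e = r0" using uniq[of e r0] \<open>P r0 = 0\<close> rd d0 by auto
          then show ?thesis using 1 rd by (intro exI[of _ e] exI[of _ x]) auto
        next
          case False
          then have "r < r0" using r by auto
          obtain e x where 1: "e \<le> r0" "x < e" "r < x" "P e = 0" "P r = - k x * (r - e)"
            using first_zero[OF r0 d(2), of r] rd \<open>r < r0\<close> \<open>P r \<noteq> 0\<close> \<open>P r0 = 0\<close> by blast
          then have "k r0 \<noteq> 0 \<longrightarrow> e = r0" using uniq[of e r0] \<open>P r0 = 0\<close> rd d0 by auto
          then show ?thesis using 1 rd by (intro exI[of _ e] exI[of _ x]) auto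
        qed
      qed
      then obtain e x where ex: "P r = - k x * (r - e)" "\<bar>r - e\<bar> \<le> \<bar>r - r0\<bar>" "\<bar>x - r0\<bar> < d"
        "k r0 \<noteq> 0 \<Longrightarrow> e = r0" by blast
      have kx: "\<bar>k x - k r0\<bar> < \<epsilon>" using d(3)[OF ex(3)] \<eta> by simp
      show "norm ((P r - P r0) / (r - r0) - - k r0) < \<epsilon>"
      proof (cases "k r0 = 0")
        case True
        have "\<bar>P r / (r - r0)\<bar> = \<bar>k x\<bar> * (\<bar>r - e\<bar> / \<bar>r - r0\<bar>)" by (simp add: ex(1) abs_mult)
        also have "\<dots> \<le> \<bar>k x\<bar> * 1"
          using ex(2) r by (intro mult_left_mono) (auto simp: divide_le_eq)
        finally show ?thesis using kx True \<open>P r0 = 0\<close> by simp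
      next
        case False
        then have "P r / (r - r0) = - k x" using ex r by simp
        then show ?thesis using kx \<open>P r0 = 0\<close> by simp
      qed
    qed
  qed
  then show ?thesis unfolding has_field_derivative_iff .
qed

end

section \<open>The radial equation\<close>

text \<open>Since \<open>(p - 1) g'' + (n - 1) g' / r = (p - 1) r\<^sup>-\<^sup>\<alpha> (r\<^sup>\<alpha> g')'\<close> for \<open>\<alpha> = (n - 1) / (p - 1)\<close>,
  the flux \<open>P = \<bar>r\<^sup>\<alpha> g'\<bar>\<^sup>q\<^sup>-\<^sup>2 r\<^sup>\<alpha> g'\<close> turns the radial equation into \<open>P' = - flux_source\<close>, and
  \<open>flux_slope r P\<close> recovers \<open>g'\<close> from \<open>P\<close>.\<close>

definition flux_source :: "real \<Rightarrow> real \<Rightarrow> real \<Rightarrow> (real \<Rightarrow> real) \<Rightarrow> real \<Rightarrow> real" where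
  "flux_source n p q f r = (q - 1) / (p - 1) * r powr ((n - 1) / (p - 1) * (q - 1)) * f r"

definition flux_slope :: "real \<Rightarrow> real \<Rightarrow> real \<Rightarrow> real \<Rightarrow> real \<Rightarrow> real" where
  "flux_slope n p q r s = r powr (- ((n - 1) / (p - 1))) * signed_power s (1 / (q - 1))"

text \<open>For the slope \<open>\<sigma> * r powr - a * P powr c\<close>, the first-order term
  cancels the derivative of \<open>r powr - a\<close> since \<open>n - 1 = (p - 1) * a\<close>. The
  powers of \<open>P\<close> cancel since \<open>c * (q - 2) + (c - 1) = 0\<close>, so the operator
  is linear in \<open>P'\<close>.\<close>

lemma radial_operator_flux_slope:
  fixes n p q r P P' \<sigma> :: real
  assumes "p > 1" "q > 1" "r > 0" "P > 0" "\<bar>\<sigma>\<bar> = 1"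
  defines "a \<equiv> (n - 1) / (p - 1)" and "c \<equiv> 1 / (q - 1)"
  shows "\<bar>\<sigma> * (r powr - a * P powr c)\<bar> powr (q - 2) *
    ((p - 1) * (\<sigma> * (- a * r powr (- a - 1) * P powr c + r powr - a * (c * P powr (c - 1) * P')))
      + (n - 1) / r * (\<sigma> * (r powr - a * P powr c)))
    = \<sigma> * ((p - 1) / (q - 1)) * r powr - (a * (q - 1)) * P'"
proof -
  have n: "n - 1 = (p - 1) * a" using assms(1) by (simp add: a_def)
  have "r powr (- a - 1) = r powr - a / r" using assms(3) by (simp add: powr_diff)
  then have 1: "(p - 1) * (\<sigma> * (- a * r powr (- a - 1) * P powr c + r powr - a * (c * P powr (c - 1) * P')))
      + (n - 1) / r * (\<sigma> * (r powr - a * P powr c)) = \<sigma> * ((p - 1) * c) * r powr - a * P powr (c - 1) * P'"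
    unfolding n by (simp add: algebra_simps)
  have 2: "\<bar>\<sigma> * (r powr - a * P powr c)\<bar> powr (q - 2) = r powr (- a * (q - 2)) * P powr (c * (q - 2))"
    using assms by (simp add: abs_mult powr_mult powr_powr)
  have "- a * (q - 2) + - a = - (a * (q - 1))" by (simp add: algebra_simps)
  then have 3: "r powr (- a * (q - 2)) * r powr - a = r powr - (a * (q - 1))"
    by (simp add: powr_add[symmetric])
  have "c * (q - 2) + (c - 1) = c * (q - 1) - 1" by (simp add: algebra_simps)
  also have "\<dots> = 0" using assms(2) by (simp add: c_def)
  finally have 4: "P powr (c * (q - 2)) * P powr (c - 1) = 1"
    using assms(4) by (simp add: powr_add[symmetric])
  have "r powr (- a * (q - 2)) * P powr (c * (q - 2)) * (\<sigma> * ((p - 1) * c) * r powr - a * P powr (c - 1) * P')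
    = \<sigma> * ((p - 1) * c) * (r powr (- a * (q - 2)) * r powr - a) * (P powr (c * (q - 2)) * P powr (c - 1)) * P'"
    by (simp add: mult_ac)
  then show ?thesis unfolding 1 2 3 4 by (simp add: c_def)
qed

section \<open>Comparison with exact solutions of nonzero flux\<close>

text \<open>This collects all that is used about the profile of a subsolution, so that the remaining
  analysis is one-dimensional. \<open>test\<close>, \<open>flat\<close> and \<open>origin\<close>
  record what radial test functions, even powers and tilted paraboloids give.\<close>

locale radial_subsolution =
  fixes n p q R :: real and f U :: "real \<Rightarrow> real"
  assumes npq: "n > 1" "p > 1" "q > 1" and R: "R > 0"
    and f: "continuous_on {0..<R} f" and U: "continuous_on {0..R} U"
    and test: "\<And>r0 T g g' g''. open T \<Longrightarrow> r0 \<in> T \<Longrightarrow> T \<subseteq> {0<..<R} \<Longrightarrow>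
      (\<And>r. r \<in> T \<Longrightarrow> (g has_real_derivative g' r) (at r)) \<Longrightarrow>
      (\<And>r. r \<in> T \<Longrightarrow> (g' has_real_derivative g'' r) (at r)) \<Longrightarrow>
      continuous_on T g'' \<Longrightarrow> g r0 = U r0 \<Longrightarrow> (\<And>r. r \<in> T \<Longrightarrow> U r \<le> g r) \<Longrightarrow> g' r0 \<noteq> 0 \<Longrightarrow>
      - (\<bar>g' r0\<bar> powr (q - 2) * ((p - 1) * g'' r0 + (n - 1) / r0 * g' r0)) \<le> f r0"
    and flat: "\<And>r0. r0 \<in> {0<..<R} \<Longrightarrow> \<forall>\<^sub>F r in nhds r0. U r = U r0 \<Longrightarrow> 0 \<le> f r0"
    and origin: "\<not> (\<forall>\<^sub>F r in at_right 0. U r \<le> U 0 - 2 * r)"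
begin

text \<open>The sign \<open>\<sigma>\<close> makes the lemma applicable to \<open>- U\<close> as well, while \<open>v\<close> stays increasing.\<close>

lemma comparison:
  assumes \<sigma>: "\<bar>\<sigma>\<bar> = 1" and ab: "0 < a" "a < b" "b < R"
    and P: "\<And>r. r \<in> {a<..<b} \<Longrightarrow> P r > 0"
    and dP: "\<And>r. r \<in> {a<..<b} \<Longrightarrow> (P has_real_derivative P' r) (at r)"
    and cP': "continuous_on {a<..<b} P'"
    and strict: "\<And>r. r \<in> {a<..<b} \<Longrightarrow> \<sigma> * P' r < - flux_source n p q f r"
    and dv: "\<And>r. r \<in> {a<..<b} \<Longrightarrow> (v has_real_derivative flux_slope n p q r (P r)) (at r)"
    and cv: "continuous_on {a..b} v"
    and r: "r \<in> {a..b}"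
  shows "U r - \<sigma> * v r \<le> max (U a - \<sigma> * v a) (U b - \<sigma> * v b)"
proof -
  define al where "al = (n - 1) / (p - 1)"
  define c where "c = 1 / (q - 1)"
  have "continuous_on {a..b} (\<lambda>r. U r - \<sigma> * v r)"
    using ab by (intro continuous_intros cv continuous_on_subset[OF U]) auto
  then obtain r0 where r0: "r0 \<in> {a..b}" "\<And>r. r \<in> {a..b} \<Longrightarrow> U r - \<sigma> * v r \<le> U r0 - \<sigma> * v r0"
    using continuous_attains_sup[of "{a..b}" "\<lambda>r. U r - \<sigma> * v r"] ab by auto
  \<comment> \<open>At an interior maximum a translate of \<open>\<sigma> * v\<close> touches
    \<open>U\<close> from above with nonzero slope; the test then contradicts the strict inequality
    for \<open>\<sigma> * P'\<close>.\<close>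
  have "r0 = a \<or> r0 = b"
  proof (rule ccontr)
    assume "\<not> (r0 = a \<or> r0 = b)"
    then have i: "r0 \<in> {a<..<b}" using r0(1) by auto
    then have r0p: "r0 > 0" "r0 < R" using ab by auto
    define g where "g r = \<sigma> * v r + (U r0 - \<sigma> * v r0)" for r
    define g' where "g' r = \<sigma> * (r powr - al * P r powr c)" for r
    define g'' where "g'' r = \<sigma> * (- al * r powr (- al - 1) * P r powr c + r powr - al * (c * P r powr (c - 1) * P' r))" for r
    have "- (\<bar>g' r0\<bar> powr (q - 2) * ((p - 1) * g'' r0 + (n - 1) / r0 * g' r0)) \<le> f r0"
    proof (rule test[of "{a<..<b}"])
      show "open {a<..<b}" "r0 \<in> {a<..<b}" "{a<..<b} \<subseteq> {0<..<R}" using i ab by auto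
      show "(g has_real_derivative g' r) (at r)" if "r \<in> {a<..<b}" for r
        unfolding g_def[abs_def] g'_def
        by (rule derivative_eq_intros dv[OF that] refl)+
          (simp add: flux_slope_def signed_power_pos[OF P[OF that]] al_def c_def)
      show "(g' has_real_derivative g'' r) (at r)" if "r \<in> {a<..<b}" for r
        unfolding g'_def[abs_def] g''_def using P[OF that] ab that
        by (auto intro!: derivative_eq_intros DERIV_fun_powr dP simp: algebra_simps)
      have "continuous_on {a<..<b} P" using dP DERIV_isCont by (blast intro: continuous_at_imp_continuous_on)
      then show "continuous_on {a<..<b} g''"
        unfolding g''_def[abs_def]
        by (intro continuous_intros cP') (use P ab in force)+
      show "g r0 = U r0" by (simp add: g_def)
      show "U r \<le> g r" if "r \<in> {a<..<b}" for r using r0(2)[of r] that by (simp add: g_def)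
      show "g' r0 \<noteq> 0" using \<sigma> P[OF i] r0p by (auto simp: g'_def)
    qed
    then have "- (\<sigma> * ((p - 1) / (q - 1)) * r0 powr - (al * (q - 1)) * P' r0) \<le> f r0"
      using radial_operator_flux_slope[OF npq(2,3) r0p(1) P[OF i] \<sigma>, of n "P' r0"]
      unfolding g'_def g''_def al_def c_def by simp
    then have "((q - 1) / (p - 1) * r0 powr (al * (q - 1))) * - (\<sigma> * ((p - 1) / (q - 1)) * r0 powr - (al * (q - 1)) * P' r0)
      \<le> ((q - 1) / (p - 1) * r0 powr (al * (q - 1))) * f r0"
      using npq by (intro mult_left_mono) auto
    moreover have "((q - 1) / (p - 1) * r0 powr (al * (q - 1))) * - (\<sigma> * ((p - 1) / (q - 1)) * r0 powr - (al * (q - 1)) * P' r0)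
      = - (\<sigma> * P' r0)"
    proof -
      have "r0 powr (al * (q - 1)) * r0 powr - (al * (q - 1)) = 1"
        using r0p by (simp add: powr_minus)
      moreover have "(q - 1) / (p - 1) * ((p - 1) / (q - 1)) = 1" using npq by simp
      moreover have "((q - 1) / (p - 1) * r0 powr (al * (q - 1))) * - (\<sigma> * ((p - 1) / (q - 1)) * r0 powr - (al * (q - 1)) * P' r0)
        = - (\<sigma> * P' r0) * ((q - 1) / (p - 1) * ((p - 1) / (q - 1))) * (r0 powr (al * (q - 1)) * r0 powr - (al * (q - 1)))"
        by (simp only: mult_ac mult_minus_left mult_minus_right)
      ultimately show ?thesis by simp
    qed
    ultimately show False using strict[OF i] by (simp add: flux_source_def al_def)
  qed
  then show ?thesis using r0(2)[OF r] by auto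
qed

end

text \<open>The supersolution half is stated as the subsolution property of \<open>- U\<close> for
  the source \<open>- f\<close>.\<close>

locale radial_solution =
  fixes n p q R :: real and f U :: "real \<Rightarrow> real"
  assumes sub: "radial_subsolution n p q R f U"
    and neg: "radial_subsolution n p q R (\<lambda>r. - f r) (\<lambda>r. - U r)"
begin

sublocale radial_subsolution n p q R f U by (rule sub)

lemma uminus_solution: "radial_solution n p q R (\<lambda>r. - f r) (\<lambda>r. - U r)"
  using sub neg by (simp add: radial_solution_def)

lemma flux_source_uminus: "flux_source n p q (\<lambda>r. - f r) r = - flux_source n p q f r"
  by (simp add: flux_source_def)

lemma continuous_flux_source: "continuous_on {0..<R} (flux_source n p q f)"
  unfolding flux_source_def[abs_def]
  by (intro continuous_on_mult continuous_on_powr' continuous_on_const continuous_on_id f)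
    (use npq in auto)

text \<open>Tilting the flux by \<open>- e * (s - a)\<close> produces strict comparison functions:
  \<open>e > 0\<close> bounds \<open>U\<close> from above, and \<open>e < 0\<close> bounds
  \<open>- U\<close> from above. Letting \<open>e\<close> tend to 0, the boundary values agree at
  both ends and the two bounds close up.\<close>

lemma representation:
  assumes ab: "0 < a" "a < b" "b < R"
    and dK: "\<And>r. r \<in> {0<..<R} \<Longrightarrow> (K has_real_derivative flux_source n p q f r) (at r)"
    and pos: "\<And>r. r \<in> {a..b} \<Longrightarrow> c - K r > 0"
    and bdry: "U b - U a = integral {a..b} (\<lambda>s. flux_slope n p q s (c - K s))"
    and r: "r \<in> {a..b}"
  shows "U r = U a + integral {a..r} (\<lambda>s. flux_slope n p q s (c - K s))"
proof -
  interpret neg: radial_subsolution n p q R "\<lambda>r. - f r" "\<lambda>r. - U r" by (rule neg)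
  have cK: "continuous_on {a..b} K"
    by (rule DERIV_continuous_on[OF has_field_derivative_at_within[OF dK]]) (use ab in auto)
  have "\<exists>x\<in>{a..b}. \<forall>y\<in>{a..b}. c - K x \<le> c - K y"
    by (rule continuous_attains_inf) (use ab cK in \<open>auto intro!: continuous_intros\<close>)
  then obtain r1 where r1: "r1 \<in> {a..b}" "\<And>r. r \<in> {a..b} \<Longrightarrow> c - K r1 \<le> c - K r"
    by blast
  define w where "w = b - a"
  have w: "w > 0" using ab by (simp add: w_def)
  \<comment> \<open>For tilts up to \<open>e0\<close> the flux changes by at most half of its
    minimum, so it stays positive.\<close>
  define e0 where "e0 = (c - K r1) / 2 / w"
  have e0: "e0 > 0" using pos[OF r1(1)] w by (simp add: e0_def)
  define P where "P e s = c - K s - e * (s - a)" for e s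
  have P: "P e s > 0" if "e \<in> {-e0..e0}" "s \<in> {a..b}" for e s
  proof -
    have "e * (s - a) \<le> e0 * w" using that e0 by (intro mult_mono) (auto simp: w_def)
    also have "\<dots> = (c - K r1) / 2" using w by (simp add: e0_def)
    also have "\<dots> < c - K r1" using pos[OF r1(1)] by simp
    also have "\<dots> \<le> c - K s" using r1 that by blast
    finally show ?thesis by (simp add: P_def)
  qed
  define J where "J e x = integral {a..x} (\<lambda>s. flux_slope n p q s (P e s))" for e x
  have slope: "flux_slope n p q s (P e s) = s powr (- ((n - 1) / (p - 1))) * P e s powr (1 / (q - 1))"
    if "e \<in> {-e0..e0}" "s \<in> {a..b}" for e s
    using P[OF that] by (simp add: flux_slope_def signed_power_pos)
  have cJ: "((\<lambda>e. J e x) \<longlongrightarrow> J 0 x) (at 0)" if x: "x \<in> {a..b}" for x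
  proof -
    have "continuous_on ({-e0..e0} \<times> cbox a x) (\<lambda>(e, s). s powr (- ((n - 1) / (p - 1))) * P e s powr (1 / (q - 1)))"
      unfolding split_beta P_def
      by (intro continuous_intros continuous_on_compose2[OF cK])
        (use x ab P in \<open>force simp: P_def\<close>)+
    then have "continuous_on ({-e0..e0} \<times> cbox a x) (\<lambda>(e, s). flux_slope n p q s (P e s))"
      by (rule continuous_on_eq) (use x slope in auto)
    from integral_continuous_on_param[OF this]
    have "continuous_on {-e0..e0} (\<lambda>e. J e x)" by (simp add: J_def)
    then have "isCont (\<lambda>e. J e x) 0" using e0 by (rule_tac continuous_on_interior) auto
    then show ?thesis by (simp add: isCont_def)
  qed
  have dJ: "(J e has_real_derivative flux_slope n p q x (P e x)) (at x)"
    and cJx: "continuous_on {a..b} (J e)"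
    if e: "e \<in> {-e0..e0}" and x: "x \<in> {a<..<b}" for e x
  proof -
    have "continuous_on {a..b} (\<lambda>s. s powr (- ((n - 1) / (p - 1))) * P e s powr (1 / (q - 1)))"
      unfolding P_def by (intro continuous_intros cK) (use ab P[OF e] in \<open>force simp: P_def\<close>)+
    then have c: "continuous_on {a..b} (\<lambda>s. flux_slope n p q s (P e s))"
      by (rule continuous_on_eq) (use slope e in auto)
    have d: "(J e has_real_derivative flux_slope n p q x (P e x)) (at x within {a..b})" if "x \<in> {a..b}" for x
      unfolding J_def[abs_def] by (rule integral_has_real_derivative[OF c that])
    then show "continuous_on {a..b} (J e)" by (rule DERIV_continuous_on)
    show "(J e has_real_derivative flux_slope n p q x (P e x)) (at x)"
      using d[of x] x by (simp add: at_within_Icc_at)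
  qed
  have mid: "(a + b) / 2 \<in> {a<..<b}" using ab by auto
  have dP: "(P e has_real_derivative - flux_source n p q f s - e) (at s)" if "s \<in> {a<..<b}" for e s
  proof -
    have "(K has_real_derivative flux_source n p q f s) (at s)" using dK that ab by simp
    then show ?thesis unfolding P_def[abs_def] by (auto intro!: derivative_eq_intros)
  qed
  have cP': "continuous_on {a<..<b} (\<lambda>s. - flux_source n p q f s - e)" for e
    using ab by (intro continuous_intros continuous_on_subset[OF continuous_flux_source]) auto
  have Ja: "J e a = 0" for e by (simp add: J_def)
  have up: "U r - J 0 r \<le> max (U a) (U b - J 0 b)"
  proof (rule tendsto_le[OF trivial_limit_at_right_real])
    show "((\<lambda>e. max (U a) (U b - J e b)) \<longlongrightarrow> max (U a) (U b - J 0 b)) (at_right 0)"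
      using cJ[of b] ab by (intro tendsto_intros) (simp add: filterlim_at_split)
    show "((\<lambda>e. U r - J e r) \<longlongrightarrow> U r - J 0 r) (at_right 0)"
      using cJ[OF r] by (intro tendsto_intros) (simp add: filterlim_at_split)
    have "\<forall>\<^sub>F e in at_right 0. e \<in> {0<..<e0}" using e0 by (rule eventually_at_right_real)
    then show "\<forall>\<^sub>F e in at_right 0. U r - J e r \<le> max (U a) (U b - J e b)"
    proof eventually_elim
      case (elim e)
      then have e: "e \<in> {-e0..e0}" by auto
      show ?case
        using comparison[of 1 a b "P e" "\<lambda>s. - flux_source n p q f s - e" "J e" r, OF _ ab _ dP cP' _ dJ cJx[OF e mid] r]
          P e elim Ja by auto
    qed
  qed
  have lo: "- U r + J 0 r \<le> max (- U a) (- U b + J 0 b)"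
  proof (rule tendsto_le[OF trivial_limit_at_left_real])
    show "((\<lambda>e. max (- U a) (- U b + J e b)) \<longlongrightarrow> max (- U a) (- U b + J 0 b)) (at_left 0)"
      using cJ[of b] ab by (intro tendsto_intros) (simp add: filterlim_at_split)
    show "((\<lambda>e. - U r + J e r) \<longlongrightarrow> - U r + J 0 r) (at_left 0)"
      using cJ[OF r] by (intro tendsto_intros) (simp add: filterlim_at_split)
    have "\<forall>\<^sub>F e in at_left 0. e \<in> {-e0<..<0}" using e0 by (intro eventually_at_left_real) auto
    then show "\<forall>\<^sub>F e in at_left 0. - U r + J e r \<le> max (- U a) (- U b + J e b)"
    proof eventually_elim
      case (elim e)
      then have e: "e \<in> {-e0..e0}" by auto
      show ?case
        using neg.comparison[of "-1" a b "P e" "\<lambda>s. - flux_source n p q f s - e" "J e" r, OF _ ab _ dP cP' _ dJ cJx[OF e mid] r]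
          P e elim Ja by (auto simp: flux_source_uminus)
    qed
  qed
  have J0: "J 0 = (\<lambda>x. integral {a..x} (\<lambda>s. flux_slope n p q s (c - K s)))"
    by (simp add: J_def P_def fun_eq_iff)
  show ?thesis using up lo bdry unfolding J0 by simp
qed

text \<open>The boundary values on a steep interval are attained by an exact solution whose flux
  \<open>c - K\<close> has no zero there: the source changes the flux by at most \<open>M (b - a)\<close>.\<close>

lemma shooting:
  assumes AB: "0 < A" "A \<le> a" "a < b" "b \<le> B" "B < R"
    and dK: "\<And>r. r \<in> {0<..<R} \<Longrightarrow> (K has_real_derivative flux_source n p q f r) (at r)"
    and M: "M > 0" "\<And>r. r \<in> {A..B} \<Longrightarrow> \<bar>flux_source n p q f r\<bar> \<le> M"
    and steep: "(b - a) * (A powr (- ((n - 1) / (p - 1))) * (3 * M * (b - a)) powr (1 / (q - 1))) < U b - U a"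
  shows "\<exists>c. (\<forall>r\<in>{a..b}. c - K r > 0) \<and>
    U b - U a = integral {a..b} (\<lambda>s. flux_slope n p q s (c - K s))"
proof -
  define al where "al = (n - 1) / (p - 1)"
  define ga where "ga = 1 / (q - 1)"
  have al: "al > 0" and ga: "ga > 0" using npq by (auto simp: al_def ga_def)
  define h where "h = b - a"
  have h: "h > 0" using AB by (simp add: h_def)
  have cK: "continuous_on {a..b} K"
    by (rule DERIV_continuous_on[OF has_field_derivative_at_within[OF dK]]) (use AB in auto)
  have Kb: "\<bar>K s - K a\<bar> \<le> M * h" if "s \<in> {a..b}" for s
  proof -
    have "norm (K s - K a) \<le> M * norm (s - a)"
    proof (rule field_differentiable_bound[of "{a..b}"])
      show "(K has_field_derivative flux_source n p q f z) (at z within {a..b})" if "z \<in> {a..b}" for z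
        using dK[of z] that AB by (auto intro: has_field_derivative_at_within)
    qed (use M AB that in auto)
    also have "\<dots> \<le> M * h" using that M(1) by (intro mult_left_mono) (auto simp: h_def)
    finally show ?thesis by simp
  qed
  define J where "J c = integral {a..b} (\<lambda>s. s powr - al * (c - K s) powr ga)" for c
  \<comment> \<open>At \<open>c1\<close> the flux lies between \<open>M * h\<close> and
    \<open>3 * M * h\<close>: it is positive, and \<open>steep\<close> says that the resulting
    increment is too small.\<close>
  define c1 where "c1 = K a + 2 * M * h"
  define Q where "Q = h * B powr - al"
  have Q: "Q > 0" using h AB by (simp add: Q_def)
  define d where "d = (U b - U a) / Q"
  \<comment> \<open>At \<open>c2\<close> the flux is at least
    \<open>\<bar>d\<bar> powr (q - 1)\<close>, hence the slope at least
    \<open>B powr - al * \<bar>d\<bar>\<close>, and the increment reaches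
    \<open>Q * d = U b - U a\<close>.\<close>
  define c2 where "c2 = K a + 2 * M * h + \<bar>d\<bar> powr (q - 1)"
  have c12: "c1 \<le> c2" by (simp add: c1_def c2_def)
  have pos: "c - K s > 0" if "c1 \<le> c" "s \<in> {a..b}" for c s
    using Kb[OF that(2)] that(1) mult_pos_pos[OF M(1) h] by (simp add: c1_def)
  have "continuous_on ({c1..c2} \<times> cbox a b) (\<lambda>(c, s). s powr - al * (c - K s) powr ga)"
    unfolding split_beta
    by (intro continuous_intros continuous_on_compose2[OF cK]) (use AB pos in force)+
  from integral_continuous_on_param[OF this]
  have cJ: "continuous_on {c1..c2} J" by (simp add: J_def[abs_def])
  have ci: "(\<lambda>s. s powr - al * (c - K s) powr ga) integrable_on {a..b}" if "c1 \<le> c" for c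
    by (rule integrable_continuous_real, intro continuous_intros cK) (use AB pos[OF that] in force)+
  have "J c1 \<le> integral {a..b} (\<lambda>s. A powr - al * (3 * M * h) powr ga)"
    unfolding J_def
  proof (rule integral_le[OF ci])
    fix s assume s: "s \<in> {a..b}"
    have "s powr - al \<le> A powr - al" using s AB al by (intro powr_mono2') auto
    moreover have "(c1 - K s) powr ga \<le> (3 * M * h) powr ga"
      using Kb[OF s] pos[OF order_refl s] ga by (intro powr_mono2) (auto simp: c1_def)
    ultimately show "s powr - al * (c1 - K s) powr ga \<le> A powr - al * (3 * M * h) powr ga"
      by (intro mult_mono) auto
  qed auto
  also have "\<dots> = h * (A powr - al * (3 * M * h) powr ga)" using AB by (simp add: h_def)
  also have "\<dots> < U b - U a" using steep by (simp add: h_def al_def ga_def)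
  finally have lo: "J c1 \<le> U b - U a" by simp
  have "U b - U a = Q * d" using Q by (simp add: d_def)
  also have "\<dots> \<le> Q * \<bar>d\<bar>" using Q by (intro mult_left_mono) auto
  also have "\<dots> = Q * ((\<bar>d\<bar> powr (q - 1)) powr ga)"
    using npq by (simp add: powr_powr ga_def)
  also have "\<dots> = integral {a..b} (\<lambda>s. B powr - al * (\<bar>d\<bar> powr (q - 1)) powr ga)"
    using AB by (simp add: h_def Q_def)
  also have "\<dots> \<le> J c2" unfolding J_def
  proof (rule integral_le[OF _ ci[OF c12]])
    fix s assume s: "s \<in> {a..b}"
    have "B powr - al \<le> s powr - al" using s AB al by (intro powr_mono2') auto
    moreover have "(\<bar>d\<bar> powr (q - 1)) powr ga \<le> (c2 - K s) powr ga"
      using Kb[OF s] mult_pos_pos[OF M(1) h] ga by (intro powr_mono2) (auto simp: c2_def)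
    ultimately show "B powr - al * (\<bar>d\<bar> powr (q - 1)) powr ga \<le> s powr - al * (c2 - K s) powr ga"
      by (intro mult_mono) auto
  qed auto
  finally have hi: "U b - U a \<le> J c2" .
  obtain c where c: "c1 \<le> c" "c \<le> c2" "J c = U b - U a"
    using IVT'[OF lo hi c12 cJ] by auto
  have "J c = integral {a..b} (\<lambda>s. flux_slope n p q s (c - K s))"
    unfolding J_def using pos[OF c(1)]
    by (intro integral_cong) (auto simp: flux_slope_def signed_power_pos al_def ga_def)
  then show ?thesis using c pos[OF c(1)] by (intro exI[of _ c]) auto
qed

text \<open>Shooting finds an exact solution with the boundary values of \<open>U\<close>,
  \<open>representation\<close> identifies it with \<open>U\<close>, and the fundamental theorem of
  calculus differentiates it.\<close>

lemma steep_interval_increasing: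
  assumes AB: "0 < A" "A \<le> a" "a < b" "b \<le> B" "B < R"
    and dK: "\<And>r. r \<in> {0<..<R} \<Longrightarrow> (K has_real_derivative flux_source n p q f r) (at r)"
    and M: "M > 0" "\<And>r. r \<in> {A..B} \<Longrightarrow> \<bar>flux_source n p q f r\<bar> \<le> M"
    and steep: "(b - a) * (A powr (- ((n - 1) / (p - 1))) * (3 * M * (b - a)) powr (1 / (q - 1))) < U b - U a"
  shows "\<exists>c. \<forall>r\<in>{a<..<b}. c - K r \<noteq> 0 \<and> (U has_real_derivative flux_slope n p q r (c - K r)) (at r)"
proof -
  obtain c where c: "\<And>r. r \<in> {a..b} \<Longrightarrow> c - K r > 0"
    "U b - U a = integral {a..b} (\<lambda>s. flux_slope n p q s (c - K s))"
    using shooting[OF AB dK M steep] by blast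
  have ab: "0 < a" "a < b" "b < R" using AB by auto
  have cK: "continuous_on {a..b} K"
    by (rule DERIV_continuous_on[OF has_field_derivative_at_within[OF dK]]) (use ab in auto)
  have "continuous_on {a..b} (\<lambda>s. s powr (- ((n - 1) / (p - 1))) * (c - K s) powr (1 / (q - 1)))"
    by (intro continuous_intros cK) (use ab c(1) in force)+
  then have cs: "continuous_on {a..b} (\<lambda>s. flux_slope n p q s (c - K s))"
    by (rule continuous_on_eq) (use c(1) in \<open>auto simp: flux_slope_def signed_power_pos\<close>)
  show ?thesis
  proof (intro exI[of _ c] ballI conjI)
    fix r assume r: "r \<in> {a<..<b}"
    show "c - K r \<noteq> 0" using c(1)[of r] r by auto
    have "((\<lambda>x. integral {a..x} (\<lambda>s. flux_slope n p q s (c - K s))) has_real_derivative flux_slope n p q r (c - K r)) (at r within {a..b})"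
      by (rule integral_has_real_derivative[OF cs]) (use r in auto)
    then have "((\<lambda>x. integral {a..x} (\<lambda>s. flux_slope n p q s (c - K s))) has_real_derivative flux_slope n p q r (c - K r)) (at r)"
      using r by (simp add: at_within_Icc_at)
    then have "((\<lambda>x. U a + integral {a..x} (\<lambda>s. flux_slope n p q s (c - K s))) has_real_derivative flux_slope n p q r (c - K r)) (at r)"
      by (auto intro!: derivative_eq_intros)
    then show "(U has_real_derivative flux_slope n p q r (c - K r)) (at r)"
    proof (rule has_field_derivative_transform_within_open[of _ _ _ "{a<..<b}"])
      show "U a + integral {a..x} (\<lambda>s. flux_slope n p q s (c - K s)) = U x" if "x \<in> {a<..<b}" for x
        by (rule representation[OF ab dK c, symmetric]) (use that in auto)
    qed (use r in auto)
  qed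
qed

end

lemma flux_slope_uminus: "flux_slope n p q r (- s) = - flux_slope n p q r s"
  by (simp add: flux_slope_def)

context radial_solution begin

lemma steep_interval:
  assumes AB: "0 < A" "A \<le> a" "a < b" "b \<le> B" "B < R"
    and dK: "\<And>r. r \<in> {0<..<R} \<Longrightarrow> (K has_real_derivative flux_source n p q f r) (at r)"
    and M: "M > 0" "\<And>r. r \<in> {A..B} \<Longrightarrow> \<bar>flux_source n p q f r\<bar> \<le> M"
    and steep: "(b - a) * (A powr (- ((n - 1) / (p - 1))) * (3 * M * (b - a)) powr (1 / (q - 1))) < \<bar>U b - U a\<bar>"
  shows "\<exists>c. \<forall>r\<in>{a<..<b}. c - K r \<noteq> 0 \<and> (U has_real_derivative flux_slope n p q r (c - K r)) (at r)"
proof (cases "U b - U a \<ge> 0")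
  case True
  then have "(b - a) * (A powr (- ((n - 1) / (p - 1))) * (3 * M * (b - a)) powr (1 / (q - 1))) < U b - U a"
    using steep by linarith
  from steep_interval_increasing[OF AB dK M this] show ?thesis .
next
  case False
  interpret neg: radial_solution n p q R "\<lambda>r. - f r" "\<lambda>r. - U r" by (rule uminus_solution)
  have dK': "((\<lambda>r. - K r) has_real_derivative flux_source n p q (\<lambda>r. - f r) r) (at r)"
    if "r \<in> {0<..<R}" for r
    using DERIV_minus[OF dK[OF that]] by (simp add: flux_source_uminus)
  have M': "\<bar>flux_source n p q (\<lambda>r. - f r) r\<bar> \<le> M" if "r \<in> {A..B}" for r
    using M(2)[OF that] by (simp add: flux_source_uminus)
  have steep': "(b - a) * (A powr (- ((n - 1) / (p - 1))) * (3 * M * (b - a)) powr (1 / (q - 1))) < - U b - - U a"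
    using steep False by linarith
  have "\<exists>c. \<forall>r\<in>{a<..<b}. c - - K r \<noteq> 0 \<and>
    ((\<lambda>r. - U r) has_real_derivative flux_slope n p q r (c - - K r)) (at r)"
    by (rule neg.steep_interval_increasing[OF AB dK' M(1) M' steep'])
  then obtain c where c: "\<And>r. r \<in> {a<..<b} \<Longrightarrow> c - - K r \<noteq> 0"
    "\<And>r. r \<in> {a<..<b} \<Longrightarrow> ((\<lambda>r. - U r) has_real_derivative flux_slope n p q r (c - - K r)) (at r)"
    by blast
  show ?thesis
  proof (intro exI[of _ "- c"] ballI conjI)
    fix r assume r: "r \<in> {a<..<b}"
    show "- c - K r \<noteq> 0" using c(1)[OF r] by simp
    have e: "- c - K r = - (c - - K r)" by simp
    show "(U has_real_derivative flux_slope n p q r (- c - K r)) (at r)"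
      unfolding e flux_slope_uminus using DERIV_minus[OF c(2)[OF r]] unfolding minus_minus .
  qed
qed

end

lemma DERIV_isconst_on_Icc:
  fixes h :: "real \<Rightarrow> real"
  assumes "continuous_on {a..b} h" "\<And>r. r \<in> {a<..<b} \<Longrightarrow> (h has_real_derivative 0) (at r)"
    and "r \<in> {a..b}"
  shows "h r = h b"
proof (cases "r = b")
  case False
  have "h b = h r"
    by (rule DERIV_isconst_end) (use assms False in \<open>auto intro: continuous_on_subset\<close>)
  then show ?thesis by simp
qed simp

section \<open>Differentiability, the flux equation and its constant\<close>

context radial_solution begin

lemma isCont_U: "r \<in> {0<..<R} \<Longrightarrow> isCont U r"
  using continuous_on_interior[OF U] by simp

text \<open>Either \<open>r0\<close> lies inside a steep interval, where \<open>U\<close> is an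
  exact solution of nonzero flux, or no interval around \<open>r0\<close> is steep. In the second
  case the difference quotients at \<open>r0\<close> are bounded by \<open>w\<close>, and the
  derivative is zero.\<close>

lemma differentiable_dichotomy:
  assumes dK': "\<forall>r\<in>{0<..<R}. (K has_real_derivative flux_source n p q f r) (at r)"
    and r0: "r0 \<in> {0<..<R}"
  shows "\<exists>D. (U has_real_derivative D) (at r0) \<and>
    (D \<noteq> 0 \<longrightarrow> (\<exists>a b c. r0 \<in> {a<..<b} \<and> {a<..<b} \<subseteq> {0<..<R} \<and>
      (\<forall>r\<in>{a<..<b}. c - K r \<noteq> 0 \<and> (U has_real_derivative flux_slope n p q r (c - K r)) (at r))))"
proof -
  note dK = bspec[OF dK']
  define A where "A = r0 / 2"
  define B where "B = (r0 + R) / 2"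
  have AB: "0 < A" "A < r0" "r0 < B" "B < R" using r0 by (auto simp: A_def B_def)
  have "compact (flux_source n p q f ` {A..B})"
    by (rule compact_continuous_image)
      (use AB in \<open>auto intro: continuous_on_subset[OF continuous_flux_source]\<close>)
  then obtain M where M: "M > 0" "\<And>r. r \<in> {A..B} \<Longrightarrow> \<bar>flux_source n p q f r\<bar> \<le> M"
    using compact_imp_bounded bounded_pos by (metis imageI real_norm_def)
  \<comment> \<open>The threshold slope for an interval of length \<open>h\<close>; it tends to 0
    with \<open>h\<close> because \<open>1 / (q - 1)\<close> is positive.\<close>
  define w where "w h = A powr (- ((n - 1) / (p - 1))) * (3 * M * h) powr (1 / (q - 1))" for h
  let ?good = "\<lambda>a b c. \<forall>r\<in>{a<..<b}. c - K r \<noteq> 0 \<and> (U has_real_derivative flux_slope n p q r (c - K r)) (at r)"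
  show ?thesis
  proof (cases "\<exists>a b. A \<le> a \<and> a < r0 \<and> r0 < b \<and> b \<le> B \<and> (b - a) * w (b - a) < \<bar>U b - U a\<bar>")
    case True
    then obtain a b where ab: "A \<le> a" "a < r0" "r0 < b" "b \<le> B" "(b - a) * w (b - a) < \<bar>U b - U a\<bar>"
      by blast
    have "a < b" using ab by simp
    from steep_interval[OF AB(1) ab(1) this ab(4) AB(4) dK M ab(5)[unfolded w_def]]
    obtain c where c: "?good a b c" by blast
    have "r0 \<in> {a<..<b}" "{a<..<b} \<subseteq> {0<..<R}" using ab AB by auto
    then show ?thesis using c by blast
  next
    case False
    then have small: "\<bar>U b - U a\<bar> \<le> (b - a) * w (b - a)" if "A \<le> a" "a < r0" "r0 < b" "b \<le> B" for a b
      using that by (meson not_le_imp_less)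
    have cont: "isCont U r0" using isCont_U[OF r0] .
    have wlim: "((\<lambda>x. (g x) * w (g x)) \<longlongrightarrow> l * w l) F" if "(g \<longlongrightarrow> l) F" "l > 0" for g l and F :: "real filter"
      unfolding w_def by (intro tendsto_intros that) (use that M in auto)
    \<comment> \<open>An interval with \<open>r0\<close> in its interior has one end at
      \<open>r\<close>; its other end is sent to \<open>r0\<close>, using continuity of
      \<open>U\<close>.\<close>
    have est: "\<bar>U r - U r0\<bar> \<le> \<bar>r - r0\<bar> * w \<bar>r - r0\<bar>" if r: "r \<in> {A<..<B}" "r \<noteq> r0" for r
    proof (cases "r0 < r")
      case True
      have "\<bar>U r - U r0\<bar> \<le> (r - r0) * w (r - r0)"
      proof (rule tendsto_le[OF trivial_limit_at_left_real])
        show "((\<lambda>a. (r - a) * w (r - a)) \<longlongrightarrow> (r - r0) * w (r - r0)) (at_left r0)"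
          by (rule wlim) (use True in \<open>auto intro!: tendsto_intros\<close>)
        show "((\<lambda>a. \<bar>U r - U a\<bar>) \<longlongrightarrow> \<bar>U r - U r0\<bar>) (at_left r0)"
          using cont by (intro tendsto_intros) (simp add: isCont_def filterlim_at_split)
        have "\<forall>\<^sub>F a in at_left r0. a \<in> {A<..<r0}" using AB(2) by (rule eventually_at_left_real)
        then show "\<forall>\<^sub>F a in at_left r0. \<bar>U r - U a\<bar> \<le> (r - a) * w (r - a)"
          by eventually_elim (use small True r in auto)
      qed
      then show ?thesis using True by simp
    next
      case False
      then have lt: "r < r0" using r by simp
      have "\<bar>U r0 - U r\<bar> \<le> (r0 - r) * w (r0 - r)"
      proof (rule tendsto_le[OF trivial_limit_at_right_real])
        show "((\<lambda>a. (a - r) * w (a - r)) \<longlongrightarrow> (r0 - r) * w (r0 - r)) (at_right r0)"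
          by (rule wlim) (use lt in \<open>auto intro!: tendsto_intros\<close>)
        show "((\<lambda>a. \<bar>U a - U r\<bar>) \<longlongrightarrow> \<bar>U r0 - U r\<bar>) (at_right r0)"
          using cont by (intro tendsto_intros) (simp add: isCont_def filterlim_at_split)
        have "\<forall>\<^sub>F a in at_right r0. a \<in> {r0<..<B}" using AB(3) by (rule eventually_at_right_real)
        then show "\<forall>\<^sub>F a in at_right r0. \<bar>U a - U r\<bar> \<le> (a - r) * w (a - r)"
          by eventually_elim (use small lt r in auto)
      qed
      then show ?thesis using lt by (simp add: abs_minus_commute)
    qed
    have "((\<lambda>r. (3 * M * \<bar>r - r0\<bar>) powr (1 / (q - 1))) \<longlongrightarrow> 0) (at r0)"
      using npq M by (intro tendsto_zero_powrI[OF _ tendsto_const]) (auto intro!: tendsto_eq_intros always_eventually)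
    then have w0: "((\<lambda>r. w \<bar>r - r0\<bar>) \<longlongrightarrow> 0) (at r0)"
      unfolding w_def using tendsto_mult_right_zero by blast
    have "\<forall>\<^sub>F r in at r0. r \<in> {A<..<B} - {r0}"
      using AB by (intro eventually_at_in_open) auto
    then have "\<forall>\<^sub>F r in at r0. norm ((U r - U r0) / (r - r0)) \<le> w \<bar>r - r0\<bar>"
    proof eventually_elim
      case (elim r)
      then show ?case using est[of r] by (simp add: abs_divide divide_le_eq mult.commute)
    qed
    then have "((\<lambda>r. (U r - U r0) / (r - r0)) \<longlongrightarrow> 0) (at r0)"
      by (rule Lim_null_comparison[OF _ w0])
    then have "(U has_real_derivative 0) (at r0)" by (simp add: has_field_derivative_iff)
    then show ?thesis by blast
  qed
qed

text \<open>The flux \<open>P\<close> is read off from the derivative of \<open>U\<close>. The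
  dichotomy gives its equation where \<open>P \<noteq> 0\<close>, \<open>degenerate_flux\<close>
  extends it to the zeros, and then \<open>P + K\<close> is constant.\<close>

lemma flux_balance:
  assumes dK': "\<forall>r\<in>{0<..<R}. (K has_real_derivative flux_source n p q f r) (at r)"
  shows "\<exists>C. \<forall>r\<in>{0<..<R}. (U has_real_derivative flux_slope n p q r (C - K r)) (at r)"
proof -
  note dK = bspec[OF dK']
  define al where "al = (n - 1) / (p - 1)"
  define P where "P r = signed_power (r powr al * deriv U r) (q - 1)" for r
  have pw: "r powr al * r powr - al = 1" if "r > 0" for r using that by (simp add: powr_minus)
  have dU: "(U has_real_derivative deriv U r) (at r)" if r: "r \<in> {0<..<R}" for r
  proof -
    obtain D where "(U has_real_derivative D) (at r)"
      using differentiable_dichotomy[OF dK' r] by blast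
    then show ?thesis using DERIV_imp_deriv[of U D r] by simp
  qed
  have slopeP: "deriv U r = flux_slope n p q r (P r)" if "r \<in> {0<..<R}" for r
  proof -
    have "signed_power (P r) (1 / (q - 1)) = r powr al * deriv U r"
      unfolding P_def by (rule signed_power_signed_power) (use npq in simp)
    then have "flux_slope n p q r (P r) = r powr al * r powr - al * deriv U r"
      unfolding flux_slope_def al_def by (simp only: mult_ac)
    then show ?thesis using pw[of r] that by simp
  qed
  have P_slope: "P r = s" if "r \<in> {0<..<R}" "(U has_real_derivative flux_slope n p q r s) (at r)" for r s
  proof -
    have "r powr al * deriv U r = r powr al * r powr - al * signed_power s (1 / (q - 1))"
      using DERIV_imp_deriv[OF that(2)] by (simp add: flux_slope_def al_def[symmetric])
    also have "\<dots> = signed_power s (1 / (q - 1))" using pw[of r] that(1) by simp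
    finally show ?thesis unfolding P_def using npq by (simp add: signed_power_signed_power)
  qed
  interpret degenerate_flux "{0<..<R}" U "deriv U" P "\<lambda>r. r powr - al" "flux_source n p q f" K "1 / (q - 1)"
  proof
    show "open {0<..<R}" "is_interval {0<..<R}" by (auto simp: is_interval_oo)
    show "(U has_real_derivative deriv U r) (at r)" if "r \<in> {0<..<R}" for r by (rule dU[OF that])
    show "deriv U r = r powr - al * signed_power (P r) (1 / (q - 1))" if "r \<in> {0<..<R}" for r
      using slopeP[OF that] by (simp add: flux_slope_def al_def)
    show "continuous_on {0<..<R} (\<lambda>r. r powr - al)" by (intro continuous_intros) auto
    show "0 < r powr - al" if "r \<in> {0<..<R}" for r using that by simp
    show "(K has_real_derivative flux_source n p q f r) (at r)" if "r \<in> {0<..<R}" for r by (rule dK[OF that])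
    show "continuous_on {0<..<R} (flux_source n p q f)"
      by (rule continuous_on_subset[OF continuous_flux_source]) auto
    show "(P has_real_derivative - flux_source n p q f r) (at r)" if r: "r \<in> {0<..<R}" and nz: "P r \<noteq> 0" for r
    proof -
      have nzd: "deriv U r \<noteq> 0" using nz by (auto simp: P_def)
      obtain D where D: "(U has_real_derivative D) (at r)" "D \<noteq> 0 \<longrightarrow> (\<exists>a b c. r \<in> {a<..<b} \<and>
        {a<..<b} \<subseteq> {0<..<R} \<and> (\<forall>r\<in>{a<..<b}. c - K r \<noteq> 0 \<and>
          (U has_real_derivative flux_slope n p q r (c - K r)) (at r)))"
        using differentiable_dichotomy[OF dK' r] by (elim exE conjE)
      have "D \<noteq> 0" using nzd DERIV_unique[OF D(1) dU[OF r]] by simp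
      then obtain a b c where c: "r \<in> {a<..<b}" "{a<..<b} \<subseteq> {0<..<R}"
        "\<And>r. r \<in> {a<..<b} \<Longrightarrow> (U has_real_derivative flux_slope n p q r (c - K r)) (at r)"
        using D(2) by blast
      have "((\<lambda>r. c - K r) has_real_derivative - flux_source n p q f r) (at r)"
        using dK[OF r] by (auto intro!: derivative_eq_intros)
      then show ?thesis
      proof (rule has_field_derivative_transform_within_open[of _ _ _ "{a<..<b}"])
        show "c - K x = P x" if "x \<in> {a<..<b}" for x
          using P_slope[OF _ c(3)[OF that]] c(2) that by auto
      qed (use c in auto)
    qed
    \<comment> \<open>Zero flux near \<open>r\<close> makes \<open>U\<close> locally constant;
      \<open>flat\<close> for \<open>U\<close> and for \<open>- U\<close> gives both signs of
      \<open>f r\<close>.\<close>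
    show "flux_source n p q f r = 0" if r: "r \<in> {0<..<R}" and ev: "\<forall>\<^sub>F s in nhds r. P s = 0" for r
    proof -
      interpret neg: radial_subsolution n p q R "\<lambda>r. - f r" "\<lambda>r. - U r" by (rule neg)
      have "\<forall>\<^sub>F s in nhds r. s \<in> {0<..<R}" by (rule eventually_nhds_in_open) (use r in auto)
      with ev have "\<forall>\<^sub>F s in nhds r. (U has_real_derivative 0) (at s)"
      proof eventually_elim
        case (elim s) then show ?case using dU[of s] slopeP[of s] by (simp add: flux_slope_def)
      qed
      then obtain d where d: "d > 0" "\<And>s. s \<in> ball r d \<Longrightarrow> (U has_real_derivative 0) (at s)"
        unfolding eventually_nhds_metric by (auto simp: dist_commute)
      have const: "U s = U r" if "s \<in> ball r d" for s
        by (rule DERIV_isconst3[of "r - d" "r + d"])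
          (use d that in \<open>auto simp: ball_eq_greaterThanLessThan\<close>)
      have "\<forall>\<^sub>F s in nhds r. s \<in> ball r d" by (rule eventually_nhds_in_open) (use d(1) in auto)
      then have c: "\<forall>\<^sub>F s in nhds r. U s = U r" by eventually_elim (rule const)
      then have "\<forall>\<^sub>F s in nhds r. - U s = - U r" by simp
      with c have "0 \<le> f r" "0 \<le> - f r" using flat[OF r] neg.flat[OF r] by blast+
      then show ?thesis by (simp add: flux_source_def)
    qed
  qed
  have const: "((\<lambda>r. P r + K r) has_real_derivative 0) (at r)" if "r \<in> {0<..<R}" for r
    using DERIV_add[OF flux_derivative[OF that] dK[OF that]] by simp
  have P: "P r = P (R / 2) + K (R / 2) - K r" if "r \<in> {0<..<R}" for r
  proof -
    have "P r + K r = P (R / 2) + K (R / 2)"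
      by (rule DERIV_isconst3[where f = "\<lambda>r. P r + K r", OF R that _ const]) (use R in auto)
    then show ?thesis by linarith
  qed
  show ?thesis
  proof (intro exI ballI)
    fix r assume r: "r \<in> {0<..<R}"
    show "(U has_real_derivative flux_slope n p q r (P (R / 2) + K (R / 2) - K r)) (at r)"
      using dU[OF r] unfolding slopeP[OF r] P[OF r] .
  qed
qed

text \<open>A nonzero constant gives the slope of the fundamental solution, which is infinite at the
  origin.\<close>

lemma flux_constant_nonneg:
  assumes K0: "(K \<longlongrightarrow> 0) (at_right 0)"
    and dU: "\<And>r. r \<in> {0<..<R} \<Longrightarrow> (U has_real_derivative flux_slope n p q r (C - K r)) (at r)"
  shows "C \<ge> 0"
proof (rule ccontr)
  assume "\<not> C \<ge> 0"
  then have C: "C < 0" by simp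
  define al where "al = (n - 1) / (p - 1)"
  define ga where "ga = 1 / (q - 1)"
  have al: "al > 0" and ga: "ga > 0" using npq by (auto simp: al_def ga_def)
  define m where "m = (- C / 2) powr ga"
  have m: "m > 0" using C by (simp add: m_def)
  \<comment> \<open>Solves \<open>d1 powr - al * m = 2\<close>: below this radius the weight
    \<open>r powr - al\<close> makes the slope at most \<open>- 2\<close>, as soon as
    \<open>K r > C / 2\<close>.\<close>
  define d1 where "d1 = (2 / m) powr (- 1 / al)"
  have d1: "d1 > 0" using m by (simp add: d1_def)
  have "\<forall>\<^sub>F r in at_right 0. K r > C / 2" using K0 C by (intro order_tendstoD) auto
  then obtain d2 where d2: "d2 > 0" "\<And>r. 0 < r \<Longrightarrow> r < d2 \<Longrightarrow> K r > C / 2"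
    unfolding eventually_at_right_field by auto
  define d where "d = min R (min d1 d2)"
  have d: "d > 0" using R d1 d2 by (simp add: d_def)
  have slope: "flux_slope n p q r (C - K r) \<le> - 2" if r: "0 < r" "r < d" for r
  proof -
    have neg: "K r - C > - C / 2" using d2(2)[of r] r by (simp add: d_def field_simps)
    have "(- C / 2) powr ga \<le> (K r - C) powr ga" using neg C ga by (intro powr_mono2) auto
    then have a: "m \<le> (K r - C) powr ga" by (simp add: m_def)
    have "d1 powr - al \<le> r powr - al" using r al by (intro powr_mono2') (auto simp: d_def)
    moreover have "d1 powr - al = 2 / m" using al m by (simp add: d1_def powr_powr)
    ultimately have "2 / m \<le> r powr - al" by simp
    then have "(2 / m) * m \<le> r powr - al * (K r - C) powr ga" using a m by (intro mult_mono) auto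
    then have "2 \<le> flux_slope n p q r (K r - C)"
      using neg C m signed_power_pos[of "K r - C"] by (simp add: flux_slope_def al_def ga_def)
    then show ?thesis using flux_slope_uminus[of n p q r "K r - C"] by simp
  qed
  have "\<forall>\<^sub>F r in at_right 0. r \<in> {0<..<d}" using d by (rule eventually_at_right_real)
  then have "\<forall>\<^sub>F r in at_right 0. U r \<le> U 0 - 2 * r"
  proof eventually_elim
    case (elim r)
    have "\<exists>l z. 0 < z \<and> z < r \<and> DERIV U z :> l \<and> U r - U 0 = (r - 0) * l"
    proof (rule MVT)
      show "continuous_on {0..r} U" by (rule continuous_on_subset[OF U]) (use elim in \<open>auto simp: d_def\<close>)
      show "U differentiable at x" if "0 < x" "x < r" for x
        using dU[of x] that elim by (auto simp: d_def real_differentiable_def)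
    qed (use elim in auto)
    then obtain l z where z: "0 < z" "z < r" "DERIV U z :> l" "U r - U 0 = r * l" by auto
    have "l = flux_slope n p q z (C - K z)"
      using DERIV_unique[OF z(3) dU[of z]] z elim by (auto simp: d_def)
    then have "l \<le> - 2" using slope[of z] z elim by simp
    then have "r * l \<le> r * (- 2)" using elim by (intro mult_left_mono) auto
    then show ?case using z(4) by simp
  qed
  then show False using origin by blast
qed

text \<open>With the antiderivative \<open>K\<close> that vanishes at the origin, the flux constant
  \<open>C\<close> is nonnegative, and the same argument for \<open>- U\<close> makes it
  nonpositive. The slope is then determined by \<open>f\<close> alone.\<close>

lemma derivative_formula:
  assumes "r \<in> {0<..<R}"
  shows "(U has_real_derivative flux_slope n p q r (- integral {0..r} (flux_source n p q f))) (at r)"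
proof -
  define K where "K r = integral {0..r} (flux_source n p q f)" for r
  have dw: "(K has_real_derivative flux_source n p q f r) (at r within {0..b})" if "r \<in> {0..b}" "b < R" for r b
    unfolding K_def[abs_def]
    by (rule integral_has_real_derivative) (use that in \<open>auto intro: continuous_on_subset[OF continuous_flux_source]\<close>)
  have dK: "(K has_real_derivative flux_source n p q f r) (at r)" if "r \<in> {0<..<R}" for r
    using dw[of r "(r + R) / 2"] that by (simp add: at_within_Icc_at)
  have "continuous (at 0 within {0..R/2}) K"
    using dw[of 0 "R / 2"] R by (auto intro: DERIV_continuous)
  then have "(K \<longlongrightarrow> K 0) (at 0 within {0..R/2})" by (simp add: continuous_within)
  then have K0: "(K \<longlongrightarrow> 0) (at_right 0)"
    using R by (simp add: at_within_Icc_at_right K_def)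
  obtain C where C: "\<And>r. r \<in> {0<..<R} \<Longrightarrow> (U has_real_derivative flux_slope n p q r (C - K r)) (at r)"
    using flux_balance[of K] dK by blast
  interpret neg: radial_solution n p q R "\<lambda>r. - f r" "\<lambda>r. - U r" by (rule uminus_solution)
  have "C \<ge> 0" by (rule flux_constant_nonneg[OF K0 C])
  moreover have "- C \<ge> 0"
  proof (rule neg.flux_constant_nonneg)
    show "((\<lambda>r. - K r) \<longlongrightarrow> 0) (at_right 0)" using tendsto_minus[OF K0] by simp
    fix r assume r: "r \<in> {0<..<R}"
    have e: "- C - - K r = - (C - K r)" by simp
    show "((\<lambda>r. - U r) has_real_derivative flux_slope n p q r (- C - - K r)) (at r)"
      unfolding e flux_slope_uminus by (rule DERIV_minus[OF C[OF r]])
  qed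
  ultimately have "C = 0" by simp
  then show ?thesis using C[OF assms] by (simp add: K_def)
qed

end

lemma radial_solution_unique:
  assumes U: "radial_solution n p q R f U" and V: "radial_solution n p q R f V"
    and R: "U R = V R" and r: "r \<in> {0..R}"
  shows "U r = V r"
proof -
  interpret U: radial_solution n p q R f U by (rule U)
  interpret V: radial_solution n p q R f V by (rule V)
  have "U r - V r = U R - V R"
  proof (rule DERIV_isconst_on_Icc[where h = "\<lambda>r. U r - V r" and a = 0])
    show "continuous_on {0..R} (\<lambda>r. U r - V r)" by (intro continuous_intros U.U V.U)
    show "((\<lambda>r. U r - V r) has_real_derivative 0) (at r)" if "r \<in> {0<..<R}" for r
      using DERIV_diff[OF U.derivative_formula[OF that] V.derivative_formula[OF that]] by simp
  qed (rule r)
  then show ?thesis using R by simp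
qed

section \<open>Uniqueness of radial solutions\<close>

text \<open>Restriction to the ray along \<open>e\<close> loses nothing, since \<open>w x\<close> is
  the profile at \<open>norm x\<close>. The three test lemmas in space supply \<open>test\<close>,
  \<open>flat\<close> and \<open>origin\<close>.\<close>

lemma radial_subsolution_profile:
  fixes w :: "real^'n \<Rightarrow> real" and e :: "real^'n"
  assumes npq: "CARD('n) \<ge> 2" "p > 1" "q > 1" "R > 0"
    and f: "continuous_on {0..<R} f" and c: "continuous_on (cball 0 R) w"
    and rad: "radial_on (cball 0 R) w" and sub: "viscosity_subsolution p q f R w"
    and e: "norm e = 1"
  shows "radial_subsolution (real CARD('n)) p q R f (\<lambda>r. w (r *\<^sub>R e))"
proof
  have W: "w x = w (norm x *\<^sub>R e)" if "x \<in> ball 0 R" for x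
    using rad that e by (simp add: radial_on_def)
  show "1 < real CARD('n)" "1 < p" "1 < q" "0 < R" using npq by auto
  show "continuous_on {0..<R} f" by (rule f)
  show "continuous_on {0..R} (\<lambda>r. w (r *\<^sub>R e))"
    by (rule continuous_on_compose2[OF c]) (use e in \<open>auto intro!: continuous_intros\<close>)
  show "- (\<bar>g' r0\<bar> powr (q - 2) * ((p - 1) * g'' r0 + (real CARD('n) - 1) / r0 * g' r0)) \<le> f r0"
    if "open T" "r0 \<in> T" "T \<subseteq> {0<..<R}"
      "\<And>r. r \<in> T \<Longrightarrow> (g has_real_derivative g' r) (at r)"
      "\<And>r. r \<in> T \<Longrightarrow> (g' has_real_derivative g'' r) (at r)"
      "continuous_on T g''" "g r0 = w (r0 *\<^sub>R e)" "\<And>r. r \<in> T \<Longrightarrow> w (r *\<^sub>R e) \<le> g r" "g' r0 \<noteq> 0"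
    for r0 T g g' g''
    using subsolution_radial_test[OF sub, of "\<lambda>r. w (r *\<^sub>R e)" T r0 g g' g''] W that by blast
  show "0 \<le> f r0" if r0: "r0 \<in> {0<..<R}"
    and ev: "\<forall>\<^sub>F r in nhds r0. w (r *\<^sub>R e) = w (r0 *\<^sub>R e)" for r0
  proof -
    have n: "norm (r0 *\<^sub>R e) = r0" using r0 e by simp
    then have m: "r0 *\<^sub>R e \<in> ball 0 R" using r0 by simp
    \<comment> \<open>Continuity of the norm turns constancy of the profile near \<open>r0\<close>
      into constancy of \<open>w\<close> near the point in space.\<close>
    have "(norm \<longlongrightarrow> norm (r0 *\<^sub>R e)) (nhds (r0 *\<^sub>R e))" by (intro tendsto_norm filterlim_ident)
    then have "\<forall>\<^sub>F x in nhds (r0 *\<^sub>R e). w (norm x *\<^sub>R e) = w (r0 *\<^sub>R e)"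
      unfolding n using ev eventually_compose_filterlim by blast
    moreover have "\<forall>\<^sub>F x in nhds (r0 *\<^sub>R e). x \<in> ball 0 R"
      by (rule eventually_nhds_in_open) (use m in auto)
    ultimately have "\<forall>\<^sub>F x in nhds (r0 *\<^sub>R e). w x = w (r0 *\<^sub>R e)"
      by eventually_elim (use W in auto)
    then have "\<forall>\<^sub>F x in at (r0 *\<^sub>R e). w x = w (r0 *\<^sub>R e)"
      by (simp add: eventually_at_filter eventually_mono)
    then show ?thesis using subsolution_locally_constant[OF sub m] npq n by simp
  qed
  show "\<not> (\<forall>\<^sub>F r in at_right 0. w (r *\<^sub>R e) \<le> w (0 *\<^sub>R e) - 2 * r)"
  proof
    assume "\<forall>\<^sub>F r in at_right 0. w (r *\<^sub>R e) \<le> w (0 *\<^sub>R e) - 2 * r"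
    then obtain d where d: "d > 0" "\<And>r. 0 < r \<Longrightarrow> r < d \<Longrightarrow> w (r *\<^sub>R e) \<le> w 0 - 2 * r"
      unfolding eventually_at_right_field by auto
    have "\<forall>\<^sub>F x in at 0. w x \<le> w 0 - 2 * norm x"
      unfolding eventually_at
    proof (intro exI[of _ "min d R"] conjI ballI impI)
      show "0 < min d R" using d npq by simp
      fix x :: "real^'n" assume "x \<noteq> 0 \<and> dist x 0 < min d R"
      then show "w x \<le> w 0 - 2 * norm x" using W[of x] d(2)[of "norm x"] by simp
    qed
    then show False using subsolution_origin[OF sub npq(4,2,1)] by blast
  qed
qed

lemma radial_solution_profile:
  fixes w :: "real^'n \<Rightarrow> real"
  assumes npq: "CARD('n) \<ge> 2" "p > 1" "q > 1" "R > 0"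
    and f: "continuous_on {0..<R} f" and c: "continuous_on (cball 0 R) w"
    and rad: "radial_on (cball 0 R) w" and sol: "viscosity_solution p q f R w"
    and e: "norm e = 1"
  shows "radial_solution (real CARD('n)) p q R f (\<lambda>r. w (r *\<^sub>R e))"
proof (rule radial_solution.intro)
  have sub: "viscosity_subsolution p q f R w" and super: "viscosity_supersolution p q f R w"
    using sol by (auto simp: viscosity_solution_def)
  show "radial_subsolution (real CARD('n)) p q R f (\<lambda>r. w (r *\<^sub>R e))"
    by (rule radial_subsolution_profile[OF npq f c rad sub e])
  show "radial_subsolution (real CARD('n)) p q R (\<lambda>r. - f r) (\<lambda>r. - w (r *\<^sub>R e))"
  proof (rule radial_subsolution_profile[OF npq _ _ _ viscosity_supersolution_uminus[OF super] e])
    show "radial_on (cball 0 R) (\<lambda>x. - w x)"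
      using rad unfolding radial_on_def by (intro ballI impI arg_cong[of _ _ uminus]) blast
  qed (intro continuous_intros f c)+
qed

theorem corollary4p3:
  fixes p q R :: real and f :: "real \<Rightarrow> real" and u h :: "real^'n \<Rightarrow> real"
  assumes "CARD('n) \<ge> 2"
    and "p > 1" and "q > 1" and "R > 0"
    and "continuous_on {0..<R} f"
    and "continuous_on (cball 0 R) u" and "continuous_on (cball 0 R) h"
    and "radial_on (cball 0 R) u" and "radial_on (cball 0 R) h"
    and "viscosity_solution p q f R u" and "viscosity_solution p q f R h"
    and "\<forall>x\<in>sphere 0 R. u x = h x"
  shows "\<forall>x\<in>cball 0 R. u x = h x"
proof
  fix x :: "real^'n" assume x: "x \<in> cball 0 R"
  obtain e :: "real^'n" where e: "norm e = 1" using vector_choose_size[of 1] by auto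
  have "u (norm x *\<^sub>R e) = h (norm x *\<^sub>R e)"
  proof (rule radial_solution_unique[of "real CARD('n)" p q R f "\<lambda>r. u (r *\<^sub>R e)" "\<lambda>r. h (r *\<^sub>R e)"])
    show "radial_solution (real CARD('n)) p q R f (\<lambda>r. u (r *\<^sub>R e))"
      by (rule radial_solution_profile) (use assms e in auto)
    show "radial_solution (real CARD('n)) p q R f (\<lambda>r. h (r *\<^sub>R e))"
      by (rule radial_solution_profile) (use assms e in auto)
    show "u (R *\<^sub>R e) = h (R *\<^sub>R e)" using assms(4,12) e by simp
    show "norm x \<in> {0..R}" using x by simp
  qed
  moreover have "norm x *\<^sub>R e \<in> cball 0 R" "norm (norm x *\<^sub>R e) = norm x" using x e by auto
  ultimately show "u x = h x" using assms(8,9) x unfolding radial_on_def by metis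
qed

end
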